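(* Let $\alpha,\beta\in[0,2\pi)$ with $\beta\notin\{\alpha,\alpha\pm\pi\}$, and let $$u=\frac{1}{\sqrt2}\begin{bmatrix}1&1\\ e^{i\alpha}&-e^{i\alpha}\end{bmatrix},\qquad v=\frac{1}{\sqrt2}\begin{bmatrix}1&1\\ e^{i\beta}&-e^{i\beta}\end{bmatrix}.$$ Then the relative commutant $(R_u\cap R_v)'\cap R$ is (isomorphic to) $\mathbb{C}\oplus\mathbb{C}$.
   Context: Spin model subfactors (for $n=2$). $M_n$ is the algebra of complex $n\times n$ matrices, $\Delta_n\subset M_n$ the diagonal subalgebra, $E_{ij}$ the matrix units, $J_n=\frac1n\sum_{i,j}E_{ij}$. A complex Hadamard matrix means here a unitary $u\in M_n$ all of whose entries have modulus $1/\sqrt n$. Consider the tower $A_{-1}=\Delta_n\subset A_0=M_n\subset A_1=\Delta_n\otimes M_n\subset A_2=M_n\otimes M_n\subset\cdots$, i.e. $A_{2k}=M_n^{\otimes (k+1)}$, $A_{2k+1}=\Delta_n\otimes M_n^{\otimes(k+1)}$, where $A_{2k}\subset A_{2k+1}$ via $x\mapsto I_n\otimes x$ and $A_{2k+1}\subset A_{2k+2}$ is induced by $\Delta_n\subset M_n$. This is a tower of Jones basic constructions with Jones projections $e_{2k+1}=\sum_i E_{ii}\otimes E_{ii}\otimes I_n^{\otimes k}\in A_{2k+1}$ ($k\ge0$) and $e_{2k}=J_n\otimes I_n^{\otimes k}\in A_{2k}$ ($k\ge 1$). $R$ is the hyperfinite $II_1$ factor obtained as the SOT-closure of $\bigcup_k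 A_k$ in the GNS representation of the normalized trace. The spin model subfactor $R_u\subset R$ is the von Neumann subalgebra generated by $u\Delta_nu^*\subset A_0$ and all $e_j$, $j\ge1$. The same $R$ and $e_j$ are used for $u$ and $v$. The condition $\beta\notin\{\alpha,\alpha\pm\pi\}$ is equivalent to $v\ne uPD$ for every permutation matrix $P$ and diagonal unitary $D$ (written $u\nsim v$), and to $R_u\ne R_v$. *)

theory Defs
  imports
    "HOL-Analysis.Bounded_Linear_Function"
    "Jordan_Normal_Form.Schur_Decomposition"
begin

class complex_hilbert = banach +
  fixes scaleC :: "complex \<Rightarrow> 'a \<Rightarrow> 'a"  (infixr "*\<^sub>C" 75)
    and cinner :: "'a \<Rightarrow> 'a \<Rightarrow> complex"
  assumes scaleC_add_right: "c *\<^sub>C (x + y) = c *\<^sub>C x + c *\<^sub>C y"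
    and scaleC_add_left: "(c + d) *\<^sub>C x = c *\<^sub>C x + d *\<^sub>C x"
    and scaleC_scaleC: "c *\<^sub>C (d *\<^sub>C x) = (c * d) *\<^sub>C x"
    and scaleR_scaleC: "r *\<^sub>R x = complex_of_real r *\<^sub>C x"
    and cinner_commute: "cinner x y = cnj (cinner y x)"
    and cinner_add_left: "cinner (x + y) z = cinner x z + cinner y z"
    and cinner_scaleC_left: "cinner (c *\<^sub>C x) y = c * cinner x y"
    and norm_eq_cinner: "norm x = sqrt (Re (cinner x x))"

lemma norm_scaleC: "norm (c *\<^sub>C x) = norm c * norm (x::'a::complex_hilbert)"
proof -
  have "cinner (c *\<^sub>C x) (c *\<^sub>C x) = (c * cnj c) * cinner x x"
    by (metis cinner_commute cinner_scaleC_left complex_cnj_mult mult.assoc)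
  also have "c * cnj c = complex_of_real ((norm c)\<^sup>2)"
    by (rule complex_norm_square [symmetric])
  finally have "Re (cinner (c *\<^sub>C x) (c *\<^sub>C x)) = (norm c)\<^sup>2 * Re (cinner x x)"
    by simp
  then show ?thesis
    by (simp add: norm_eq_cinner real_sqrt_mult)
qed

text \<open>The elements of \<open>'h \<Rightarrow>\<^sub>L 'h\<close> are the bounded real-linear maps; \<open>bounded_ops\<close> is the
  algebra of the complex-linear ones. It is closed in the strong operator topology.\<close>

definition bounded_ops :: "('h::complex_hilbert \<Rightarrow>\<^sub>L 'h) set" where
  "bounded_ops = {T. \<forall>c \<xi>. blinfun_apply T (c *\<^sub>C \<xi>) = c *\<^sub>C blinfun_apply T \<xi>}"

lift_definition scaleC_op ::
  "complex \<Rightarrow> ('h::complex_hilbert \<Rightarrow>\<^sub>L 'h) \<Rightarrow> 'h \<Rightarrow>\<^sub>L 'h" is "\<lambda>c T \<xi>. c *\<^sub>C T \<xi>"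
proof -
  fix c and T :: "'h \<Rightarrow> 'h"
  have "bounded_linear (\<lambda>\<xi>::'h. c *\<^sub>C \<xi>)"
    by (rule bounded_linear_intro [where K = "norm c"])
      (simp_all add: scaleC_add_right scaleR_scaleC scaleC_scaleC norm_scaleC mult.commute)
  moreover assume "bounded_linear T"
  ultimately show "bounded_linear (\<lambda>\<xi>. c *\<^sub>C T \<xi>)"
    by (rule bounded_linear_compose)
qed

definition is_adjoint ::
  "('h::complex_hilbert \<Rightarrow>\<^sub>L 'h) \<Rightarrow> ('h \<Rightarrow>\<^sub>L 'h) \<Rightarrow> bool" where
  "is_adjoint T S \<longleftrightarrow>
     (\<forall>\<xi> \<eta>. cinner (blinfun_apply T \<xi>) \<eta> = cinner \<xi> (blinfun_apply S \<eta>))"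

definition unital_star_subalgebra :: "('h::complex_hilbert \<Rightarrow>\<^sub>L 'h) set \<Rightarrow> bool" where
  "unital_star_subalgebra M \<longleftrightarrow>
     M \<subseteq> bounded_ops \<and> id_blinfun \<in> M \<and>
     (\<forall>S\<in>M. \<forall>T\<in>M. S + T \<in> M \<and> S o\<^sub>L T \<in> M) \<and>
     (\<forall>c. \<forall>T\<in>M. scaleC_op c T \<in> M) \<and>
     (\<forall>T\<in>M. \<exists>S\<in>M. is_adjoint T S)"

definition von_neumann_algebra :: "('h::complex_hilbert \<Rightarrow>\<^sub>L 'h) set \<Rightarrow> bool" where
  "von_neumann_algebra M \<longleftrightarrow>
     unital_star_subalgebra M \<and> closedin strong_operator_topology M"

definition von_neumann_generated ::
  "('h::complex_hilbert \<Rightarrow>\<^sub>L 'h) set \<Rightarrow> ('h \<Rightarrow>\<^sub>L 'h) set" where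
  "von_neumann_generated X = \<Inter>{M. von_neumann_algebra M \<and> X \<subseteq> M}"

definition relative_commutant ::
  "('h::complex_hilbert \<Rightarrow>\<^sub>L 'h) set \<Rightarrow> ('h \<Rightarrow>\<^sub>L 'h) set \<Rightarrow> ('h \<Rightarrow>\<^sub>L 'h) set" where
  "relative_commutant N M = {x \<in> M. \<forall>y\<in>N. x o\<^sub>L y = y o\<^sub>L x}"

definition star_isomorphic_C_plus_C :: "('h::complex_hilbert \<Rightarrow>\<^sub>L 'h) set \<Rightarrow> bool" where
  "star_isomorphic_C_plus_C M \<longleftrightarrow>
     unital_star_subalgebra M \<and>
     (\<exists>\<phi> :: ('h \<Rightarrow>\<^sub>L 'h) \<Rightarrow> complex \<times> complex.
        bij_betw \<phi> M UNIV \<and>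
        \<phi> id_blinfun = (1, 1) \<and>
        (\<forall>S\<in>M. \<forall>T\<in>M. \<phi> (S + T) = (fst (\<phi> S) + fst (\<phi> T), snd (\<phi> S) + snd (\<phi> T))) \<and>
        (\<forall>S\<in>M. \<forall>T\<in>M. \<phi> (S o\<^sub>L T) = (fst (\<phi> S) * fst (\<phi> T), snd (\<phi> S) * snd (\<phi> T))) \<and>
        (\<forall>c. \<forall>T\<in>M. \<phi> (scaleC_op c T) = (c * fst (\<phi> T), c * snd (\<phi> T))) \<and>
        (\<forall>S\<in>M. \<forall>T\<in>M. is_adjoint T S \<longrightarrow> \<phi> S = (cnj (fst (\<phi> T)), cnj (snd (\<phi> T)))))"

definition kron :: "complex mat \<Rightarrow> complex mat \<Rightarrow> complex mat" where
  "kron A B = mat (dim_row A * dim_row B) (dim_col A * dim_col B)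
     (\<lambda>(i, j). A $$ (i div dim_row B, j div dim_col B) * B $$ (i mod dim_row B, j mod dim_col B))"

inductive_set alg_tensor :: "complex mat set \<Rightarrow> complex mat set \<Rightarrow> complex mat set"
  for A B where
  kron_in_alg_tensor: "a \<in> A \<Longrightarrow> b \<in> B \<Longrightarrow> kron a b \<in> alg_tensor A B"
| add_in_alg_tensor: "x \<in> alg_tensor A B \<Longrightarrow> y \<in> alg_tensor A B \<Longrightarrow> x + y \<in> alg_tensor A B"

definition diag_alg :: "nat \<Rightarrow> complex mat set" where
  "diag_alg n = {d \<in> carrier_mat n n. diagonal_mat d}"

definition matrix_unit :: "nat \<Rightarrow> nat \<Rightarrow> nat \<Rightarrow> complex mat" where
  "matrix_unit n i j = mat n n (\<lambda>(r, c). if r = i \<and> c = j then 1 else 0)"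

text \<open>\<open>full_power n k\<close> is the tensor product of \<open>k\<close> copies of the algebra of \<open>n \<times> n\<close> matrices,
  identified via the Kronecker product with the algebra of matrices of size \<open>n ^ k\<close>.\<close>

definition full_power :: "nat \<Rightarrow> nat \<Rightarrow> complex mat set" where
  "full_power n k = carrier_mat (n ^ k) (n ^ k)"

text \<open>The tower starts at index 0; the diagonal algebra that precedes it contributes nothing to the
  union.\<close>

definition tower :: "nat \<Rightarrow> nat \<Rightarrow> complex mat set" where
  "tower n k = (if even k then full_power n (k div 2 + 1)
                else alg_tensor (diag_alg n) (full_power n (k div 2 + 1)))"

definition tower_dim :: "nat \<Rightarrow> nat \<Rightarrow> nat" where
  "tower_dim n k = (if even k then n ^ (k div 2 + 1) else n ^ (k div 2 + 2))"

text \<open>The inclusion of the \<open>k\<close>-th algebra into the next one. New tensor factors appear on the left.\<close>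

definition tower_incl :: "nat \<Rightarrow> nat \<Rightarrow> complex mat \<Rightarrow> complex mat" where
  "tower_incl n k x = (if even k then kron (1\<^sub>m n) x else x)"

definition normalized_trace :: "complex mat \<Rightarrow> complex" where
  "normalized_trace x = (\<Sum>i<dim_row x. x $$ (i, i)) / of_nat (dim_row x)"

definition J_mat :: "nat \<Rightarrow> complex mat" where
  "J_mat n = mat n n (\<lambda>(r, c). \<Sum>i<n. \<Sum>j<n. matrix_unit n i j $$ (r, c) / of_nat n)"

definition diag_jones :: "nat \<Rightarrow> complex mat" where
  "diag_jones n = mat (n * n) (n * n)
     (\<lambda>(r, c). \<Sum>i<n. kron (matrix_unit n i i) (matrix_unit n i i) $$ (r, c))"

text \<open>The Jones projection in the \<open>j\<close>-th algebra, meant for \<open>j \<ge> 1\<close>; the identity matrix of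
  size \<open>n ^ k\<close> is the unit of the \<open>k\<close>-fold tensor power.\<close>

definition jones_projection :: "nat \<Rightarrow> nat \<Rightarrow> complex mat" where
  "jones_projection n j =
     kron (if even j then J_mat n else diag_jones n) (1\<^sub>m (n ^ (j div 2)))"

text \<open>A family of compatible maps \<open>\<pi> k\<close> on the algebras of the tower is the same thing as
  a map on their increasing union. The triple consisting of the ambient Hilbert space \<open>'h\<close>, \<open>\<pi>\<close>
  and the unit vector \<open>\<Omega>\<close> is the GNS representation of that union with respect to the normalized
  trace: it is a cyclic unital \<open>*\<close>-representation whose cyclic vector implements the trace, and
  these properties determine it up to unitary equivalence.\<close>

definition gns_representation ::
  "nat \<Rightarrow> (nat \<Rightarrow> complex mat \<Rightarrow> 'h \<Rightarrow>\<^sub>L 'h) \<Rightarrow> 'h::complex_hilbert \<Rightarrow> bool" where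
  "gns_representation n \<pi> \<Omega> \<longleftrightarrow>
     (\<forall>k. \<forall>x\<in>tower n k. \<pi> k x \<in> bounded_ops) \<and>
     (\<forall>k. \<pi> k (1\<^sub>m (tower_dim n k)) = id_blinfun) \<and>
     (\<forall>k. \<forall>x\<in>tower n k. \<forall>y\<in>tower n k. \<pi> k (x + y) = \<pi> k x + \<pi> k y) \<and>
     (\<forall>k. \<forall>x\<in>tower n k. \<forall>y\<in>tower n k. \<pi> k (x * y) = \<pi> k x o\<^sub>L \<pi> k y) \<and>
     (\<forall>k c. \<forall>x\<in>tower n k. \<pi> k (c \<cdot>\<^sub>m x) = scaleC_op c (\<pi> k x)) \<and>
     (\<forall>k. \<forall>x\<in>tower n k. is_adjoint (\<pi> k x) (\<pi> k (mat_adjoint x))) \<and>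
     (\<forall>k. \<forall>x\<in>tower n k. \<pi> (Suc k) (tower_incl n k x) = \<pi> k x) \<and>
     (\<forall>k. \<forall>x\<in>tower n k. cinner (blinfun_apply (\<pi> k x) \<Omega>) \<Omega> = normalized_trace x) \<and>
     closure (\<Union>k. (\<lambda>x. blinfun_apply (\<pi> k x) \<Omega>) ` tower n k) = UNIV"

definition hyperfinite_R ::
  "nat \<Rightarrow> (nat \<Rightarrow> complex mat \<Rightarrow> 'h \<Rightarrow>\<^sub>L 'h) \<Rightarrow> ('h::complex_hilbert \<Rightarrow>\<^sub>L 'h) set" where
  "hyperfinite_R n \<pi> = strong_operator_topology closure_of (\<Union>k. \<pi> k ` tower n k)"

definition spin_subfactor ::
  "nat \<Rightarrow> (nat \<Rightarrow> complex mat \<Rightarrow> 'h \<Rightarrow>\<^sub>L 'h) \<Rightarrow> complex mat \<Rightarrow> ('h::complex_hilbert \<Rightarrow>\<^sub>L 'h) set" where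
  "spin_subfactor n \<pi> u = von_neumann_generated
     ({\<pi> 0 (u * d * mat_adjoint u) |d. d \<in> diag_alg n} \<union>
      {\<pi> j (jones_projection n j) |j. 1 \<le> j})"

definition hadamard2 :: "real \<Rightarrow> complex mat" where
  "hadamard2 \<alpha> = complex_of_real (1 / sqrt 2) \<cdot>\<^sub>m
     mat_of_rows_list 2 [[1, 1], [exp (\<i> * complex_of_real \<alpha>), - exp (\<i> * complex_of_real \<alpha>)]]"

end

theory Submission
  imports Defs
    "HOL-Analysis.Abstract_Topological_Spaces"
    "HOL-Analysis.Complex_Transcendental"
begin

text \<open>
  Write \<open>X\<close> and \<open>Z\<close> for the Pauli matrices and \<open>X\<^sub>k\<close>, \<open>Z\<^sub>k\<close> for their copies in the \<open>k\<close>-th tensor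
  factor, counted from the right. Up to affine changes the Jones projections are \<open>X\<^sub>k\<close> for \<open>k \<ge> 1\<close>
  and \<open>Z\<^sub>k Z\<^sub>k\<^sub>+\<^sub>1\<close> for \<open>k \<ge> 0\<close>. The algebra \<open>u \<Delta> u\<^sup>*\<close> is generated by
  \<open>flip \<alpha> = u Z u\<^sup>*\<close>, the off-diagonal unitary with entries \<open>exp (\<plusminus> \<i> \<alpha>)\<close>. All these generators are fixed by
  the symmetry \<open>\<theta>\<^sub>\<alpha>\<close> that conjugates with \<open>flip \<alpha>\<close> in factor 0 and with \<open>X\<close> in all other factors.
  The claim is that the relative commutant is the diagonal algebra \<open>\<Delta>\<close> of factor 0.

  \<^emph>\<open>The diagonal algebra commutes with the intersection.\<close> The symmetry \<open>\<theta>\<^sub>\<alpha>\<close> is not inner, but it is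
  implemented by a self-adjoint unitary \<open>V\<^sub>\<alpha>\<close> of the GNS space, so that the spin model subfactor with
  parameter \<open>\<alpha>\<close> lies in the commutant of \<open>V\<^sub>\<alpha>\<close>. An operator in both subfactors commutes with \<open>V\<^sub>\<alpha> V\<^sub>\<beta>\<close>, which acts
  on \<open>x \<Omega>\<close> as \<open>x \<Omega> \<mapsto> w x w\<^sup>* \<Omega>\<close> with \<open>w = flip \<alpha> * flip \<beta>\<close> in factor 0: the infinitely many other
  factors cancel. It also commutes with right multiplication by \<open>w\<close>, because all generators do.
  So it commutes with left multiplication by \<open>w\<close>. This is a diagonal matrix, whose entries
  \<open>exp (\<plusminus> \<i> (\<beta> - \<alpha>))\<close> are distinct exactly because \<open>\<beta> - \<alpha>\<close> is not a multiple of \<open>pi\<close>; hence it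
  generates \<open>\<Delta>\<close> (\<open>intersection_commutes_with_diag_op\<close>).

  \<^emph>\<open>Nothing else does.\<close> Both subfactors contain all Jones projections. Let \<open>x\<close> in \<open>R\<close> commute with
  them. By the trace property the functional \<open>b \<mapsto> \<langle>b \<Omega>, x \<Omega>\<rangle>\<close> on the tower is centralized by the Jones
  projections, that is, it takes the same value on \<open>e b\<close> and \<open>b e\<close>. By descent along the tensor
  factors such a functional is determined by its values on \<open>E\<^sub>0\<^sub>0\<close> and \<open>E\<^sub>1\<^sub>1\<close> in factor 0
  (\<open>centralized_functional_zero\<close>). Subtracting a suitable element of \<open>\<Delta>\<close> from \<open>x\<close> makes both
  values vanish, and then the difference is \<open>0\<close> because \<open>\<Omega>\<close> is separating
  (\<open>commutes_with_jones_zero\<close>).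

  Membership in a generated von Neumann algebra is only ever used through commutants of symmetric
  operators on the Hilbert space. These are von Neumann algebras as soon as every bounded operator
  has an adjoint, which is proved by Riesz representation.
\<close>

section \<open>Bounded operators on a complex Hilbert space\<close>

lemma cinner_add_right: "cinner x (y + z) = cinner x y + cinner (x::'a::complex_hilbert) z"
  by (metis cinner_add_left cinner_commute complex_cnj_add)

lemma cinner_scaleC_right: "cinner x (c *\<^sub>C y) = cnj c * cinner (x::'a::complex_hilbert) y"
  by (metis cinner_scaleC_left cinner_commute complex_cnj_mult)

lemma cinner_scaleR_left: "cinner (r *\<^sub>R x) y = of_real r * cinner (x::'a::complex_hilbert) y"
  by (simp add: scaleR_scaleC cinner_scaleC_left)

lemma cinner_scaleR_right: "cinner x (r *\<^sub>R y) = of_real r * cinner (x::'a::complex_hilbert) y"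
  by (simp add: scaleR_scaleC cinner_scaleC_right)

lemma cinner_minus_left: "cinner (- x) y = - cinner (x::'a::complex_hilbert) y"
  using cinner_scaleR_left [of "-1" x y] by simp

lemma cinner_minus_right: "cinner x (- y) = - cinner (x::'a::complex_hilbert) y"
  using cinner_scaleR_right [of x "-1" y] by simp

lemma cinner_zero_left [simp]: "cinner 0 y = (0::complex)" for y :: "'a::complex_hilbert"
  using cinner_scaleR_left [of 0 0 y] by simp

lemma cinner_zero_right [simp]: "cinner y 0 = (0::complex)" for y :: "'a::complex_hilbert"
  using cinner_scaleR_right [of y 0 0] by simp

lemma cinner_diff_left: "cinner (x - z) y = cinner x y - cinner (z::'a::complex_hilbert) y"
  using cinner_add_left [of x "- z" y] by (simp add: cinner_minus_left)

lemma Re_cinner_self: "Re (cinner x x) = (norm (x::'a::complex_hilbert))\<^sup>2"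
proof -
  have "0 \<le> Re (cinner x x)"
    using norm_ge_zero [of x] unfolding norm_eq_cinner real_sqrt_ge_0_iff .
  then show ?thesis
    by (simp add: norm_eq_cinner)
qed

lemma Re_cinner_commute: "Re (cinner x y) = Re (cinner y (x::'a::complex_hilbert))"
  by (subst cinner_commute) simp

lemma norm_add_square:
  "(norm (x + y))\<^sup>2 = (norm x)\<^sup>2 + 2 * Re (cinner x y) + (norm (y::'a::complex_hilbert))\<^sup>2"
  using Re_cinner_commute [of x y]
  by (simp add: Re_cinner_self [symmetric] cinner_add_left cinner_add_right)

lemma norm_diff_square:
  "(norm (x - y))\<^sup>2 = (norm x)\<^sup>2 - 2 * Re (cinner x y) + (norm (y::'a::complex_hilbert))\<^sup>2"
  using norm_add_square [of x "- y"] by (simp add: cinner_minus_right)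

lemma Im_cinner: "Im (cinner x y) = Re (cinner (x::'a::complex_hilbert) (\<i> *\<^sub>C y))"
  by (simp add: cinner_scaleC_right)

text \<open>Polarization writes the inner product in terms of the norm, which makes it continuous.\<close>

lemma Re_cinner_polarization:
  "Re (cinner x y) = ((norm (x + y))\<^sup>2 - (norm (x - (y::'a::complex_hilbert)))\<^sup>2) / 4"
  by (simp add: norm_add_square norm_diff_square)

lemma continuous_on_scaleC:
  "continuous_on S (\<lambda>t. c *\<^sub>C f t)"
  if "continuous_on S f" for f :: "'b::topological_space \<Rightarrow> 'a::complex_hilbert"
proof -
  have "bounded_linear (\<lambda>\<xi>::'a. c *\<^sub>C \<xi>)"
    by (rule bounded_linear_intro [where K = "norm c"])
      (simp_all add: scaleC_add_right scaleR_scaleC scaleC_scaleC norm_scaleC mult.commute)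
  then show ?thesis
    using that by (rule bounded_linear.continuous_on)
qed

lemma continuous_on_cinner:
  fixes f g :: "'b::topological_space \<Rightarrow> 'a::complex_hilbert"
  assumes "continuous_on S f" and "continuous_on S g"
  shows "continuous_on S (\<lambda>t. cinner (f t) (g t))"
proof -
  have Re: "continuous_on S (\<lambda>t. Re (cinner (f t) (h t)))"
    if "continuous_on S h" for h :: "'b \<Rightarrow> 'a"
    unfolding Re_cinner_polarization using assms(1) that
    by (intro continuous_intros) auto
  have eq: "cinner (f t) (g t)
      = Complex (Re (cinner (f t) (g t))) (Re (cinner (f t) (\<i> *\<^sub>C g t)))" for t
    by (simp add: Im_cinner [symmetric])
  show ?thesis
    by (subst eq) (intro continuous_on_Complex Re continuous_on_scaleC assms)
qed

lemma Re_cinner_le: "Re (cinner x y) \<le> norm x * norm (y::'a::complex_hilbert)"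
proof (cases "x = 0 \<or> y = 0")
  case False
  have "0 \<le> (norm ((1 / norm x) *\<^sub>R x - (1 / norm y) *\<^sub>R y))\<^sup>2"
    by simp
  also have "\<dots> = 2 - 2 * (Re (cinner x y) / (norm x * norm y))"
    using False unfolding norm_diff_square
    by (simp add: cinner_scaleR_left cinner_scaleR_right power_divide)
  finally show ?thesis
    using False by (simp add: divide_le_eq)
qed auto

lemma cinner_eqI:
  assumes "\<And>\<zeta>. cinner \<xi> \<zeta> = cinner \<eta> (\<zeta>::'a::complex_hilbert)"
  shows "\<xi> = \<eta>"
proof -
  have "cinner (\<xi> - \<eta>) (\<xi> - \<eta>) = 0"
    by (simp add: cinner_diff_left assms)
  then show ?thesis
    using Re_cinner_self [of "\<xi> - \<eta>"] by simp
qed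

text \<open>Existence of a representing vector: with \<open>f\<close> bounded by \<open>K\<close>, the functional
  \<open>\<parallel>\<xi>\<parallel>\<^sup>2 - 2 f \<xi>\<close> is bounded below by \<open>- K\<^sup>2\<close>, its minimizing sequences are Cauchy by the parallelogram
  law, and the first-order condition at the minimum says that the minimum represents \<open>f\<close>.\<close>

lemma Riesz_representation_real:
  fixes f :: "'a::complex_hilbert \<Rightarrow> real"
  assumes f: "bounded_linear f"
  obtains \<zeta> where "\<And>\<xi>. f \<xi> = Re (cinner \<xi> \<zeta>)"
proof -
  interpret bounded_linear f by (rule f)
  define q where "q \<xi> = (norm \<xi>)\<^sup>2 - 2 * f \<xi>" for \<xi>
  obtain K where K: "\<And>\<xi>. norm (f \<xi>) \<le> norm \<xi> * K"
    using bounded by blast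
  have "- K\<^sup>2 \<le> q \<xi>" for \<xi>
  proof -
    have "0 \<le> (norm \<xi> - K)\<^sup>2" by simp
    moreover have "f \<xi> \<le> norm \<xi> * K" using K [of \<xi>] by simp
    ultimately show ?thesis unfolding q_def power2_diff by simp
  qed
  then have bdd: "bdd_below (range q)" by (auto simp: bdd_below_def)
  define I where "I = Inf (range q)"
  have I_le: "I \<le> q \<xi>" for \<xi>
    unfolding I_def using bdd by (simp add: cInf_lower)
  have "\<exists>\<xi>. q \<xi> < I + 1 / Suc n" for n
    using cInf_lessD [of "range q" "I + 1 / Suc n"] unfolding I_def by auto
  then obtain s where s: "\<And>n. q (s n) < I + 1 / Suc n" by metis
  have par: "(norm (\<xi> - \<eta>))\<^sup>2 \<le> 2 * q \<xi> + 2 * q \<eta> - 4 * I" for \<xi> \<eta>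
  proof -
    have "4 * q ((1/2) *\<^sub>R \<zeta>) = (norm \<zeta>)\<^sup>2 - 4 * f \<zeta>" for \<zeta>
      unfolding q_def by (simp add: scaleR power_divide)
    then have "4 * q ((1/2) *\<^sub>R (\<xi> + \<eta>)) = (norm (\<xi> + \<eta>))\<^sup>2 - 4 * f \<xi> - 4 * f \<eta>"
      by (simp only: add right_diff_distrib distrib_left diff_diff_eq)
    moreover have "(norm (\<xi> + \<eta>))\<^sup>2 + (norm (\<xi> - \<eta>))\<^sup>2 = 2 * (norm \<xi>)\<^sup>2 + 2 * (norm \<eta>)\<^sup>2"
      by (simp add: norm_add_square norm_diff_square)
    ultimately show ?thesis
      using I_le [of "(1/2) *\<^sub>R (\<xi> + \<eta>)"] q_def [of \<xi>] q_def [of \<eta>] by linarith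
  qed
  have "Cauchy s"
  proof (rule metric_CauchyI)
    fix e :: real assume e: "0 < e"
    obtain N where N: "4 / real (Suc N) < e\<^sup>2"
      using reals_Archimedean [of "e\<^sup>2 / 4"] e by (auto simp: field_simps)
    show "\<exists>M. \<forall>m\<ge>M. \<forall>n\<ge>M. dist (s m) (s n) < e"
    proof (intro exI allI impI)
      fix m n assume "N \<le> m" "N \<le> n"
      then have "1 / real (Suc m) \<le> 1 / real (Suc N)" "1 / real (Suc n) \<le> 1 / real (Suc N)"
        by (simp_all add: frac_le)
      then have "(norm (s m - s n))\<^sup>2 < e\<^sup>2"
        using par [of "s m" "s n"] s [of m] s [of n] N by linarith
      then show "dist (s m) (s n) < e"
        using e by (simp add: dist_norm power_less_imp_less_base)
    qed
  qed
  then obtain \<zeta> where \<zeta>: "s \<longlonglongrightarrow> \<zeta>"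
    using Cauchy_convergent convergent_def by blast
  have "(\<lambda>n. q (s n)) \<longlonglongrightarrow> q \<zeta>"
    unfolding q_def by (intro tendsto_intros tendsto \<zeta>)
  moreover have "(\<lambda>n. I + 1 / Suc n) \<longlonglongrightarrow> I + 0"
    by (intro tendsto_intros LIMSEQ_inverse_real_of_nat [unfolded inverse_eq_divide])
  ultimately have "q \<zeta> \<le> I"
    using s by (force intro: LIMSEQ_le less_imp_le)
  then have min: "q \<zeta> \<le> q \<xi>" for \<xi> using I_le order_trans by blast
  have "f \<xi> = Re (cinner \<xi> \<zeta>)" for \<xi>
  proof (rule ccontr)
    define d where "d = Re (cinner \<zeta> \<xi>) - f \<xi>"
    assume "f \<xi> \<noteq> Re (cinner \<xi> \<zeta>)"
    then have d: "d \<noteq> 0" unfolding d_def using Re_cinner_commute [of \<xi> \<zeta>] by simp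
    have quad: "0 \<le> 2 * t * d + t\<^sup>2 * (norm \<xi>)\<^sup>2" for t
      using min [of "\<zeta> + t *\<^sub>R \<xi>"] unfolding q_def norm_add_square d_def
      by (simp add: add scaleR cinner_scaleR_right power_mult_distrib algebra_simps)
    \<comment> \<open>The minimizer of the quadratic is \<open>- d / \<parallel>\<xi>\<parallel>\<^sup>2\<close>; adding 1 avoids a case split on \<open>\<xi> = 0\<close>.\<close>
    define c where "c = (norm \<xi>)\<^sup>2 + 1"
    have c: "c > 0" unfolding c_def by (simp add: add_nonneg_pos)
    have "0 \<le> (2 * (- d / c) * d + (- d / c)\<^sup>2 * (norm \<xi>)\<^sup>2) * c\<^sup>2"
      using quad [of "- d / c"] by simp
    also have "\<dots> = - d\<^sup>2 * (2 * c - (norm \<xi>)\<^sup>2)"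
      using c by (simp add: field_simps power2_eq_square)
    also have "\<dots> < 0"
      using d unfolding c_def by (simp add: add_nonneg_pos)
    finally show False by simp
  qed
  then show thesis by (rule that)
qed

lemma bounded_ops_scaleC:
  "T \<in> bounded_ops \<Longrightarrow> blinfun_apply T (c *\<^sub>C \<xi>) = c *\<^sub>C blinfun_apply T \<xi>"
  by (simp add: bounded_ops_def)

lemma adjoint_unique:
  assumes "is_adjoint T S" and "is_adjoint T S'"
  shows "S = S'"
proof (rule blinfun_eqI)
  fix \<eta>
  have "cinner (blinfun_apply S \<eta>) \<xi> = cinner (blinfun_apply S' \<eta>) \<xi>" for \<xi>
    using assms unfolding is_adjoint_def by (metis cinner_commute)
  then show "blinfun_apply S \<eta> = blinfun_apply S' \<eta>"
    by (rule cinner_eqI)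
qed

lemma is_adjoint_sym: "is_adjoint T S \<Longrightarrow> is_adjoint S T"
  unfolding is_adjoint_def by (metis cinner_commute)

text \<open>The real functional \<open>Re \<langle>T \<xi>, \<eta>\<rangle>\<close> is enough: its representing vector also gives the imaginary
  part, by complex linearity of \<open>T\<close> applied to \<open>\<i> \<xi>\<close>.\<close>

lemma adjoint_exists:
  fixes T :: "'h::complex_hilbert \<Rightarrow>\<^sub>L 'h"
  assumes T: "T \<in> bounded_ops"
  obtains S where "S \<in> bounded_ops" and "is_adjoint T S"
proof -
  have bl: "bounded_linear (\<lambda>\<xi>. Re (cinner (blinfun_apply T \<xi>) \<eta>))" for \<eta>
  proof (rule bounded_linear_intro [where K = "norm T * norm \<eta>"])
    fix \<xi>
    have "\<bar>Re (cinner (blinfun_apply T \<xi>) \<eta>)\<bar> \<le> norm (blinfun_apply T \<xi>) * norm \<eta>"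
      using Re_cinner_le [of "blinfun_apply T \<xi>" \<eta>] Re_cinner_le [of "- blinfun_apply T \<xi>" \<eta>]
      by (simp add: cinner_minus_left abs_le_iff)
    also have "\<dots> \<le> norm \<xi> * (norm T * norm \<eta>)"
      using mult_right_mono [OF norm_blinfun [of T \<xi>] norm_ge_zero [of \<eta>]] by (simp add: ac_simps)
    finally show "norm (Re (cinner (blinfun_apply T \<xi>) \<eta>)) \<le> norm \<xi> * (norm T * norm \<eta>)"
      by simp
  qed (simp_all add: blinfun.add_right blinfun.scaleR_right cinner_add_left cinner_scaleR_left)
  have "\<exists>\<zeta>. \<forall>\<xi>. Re (cinner (blinfun_apply T \<xi>) \<eta>) = Re (cinner \<xi> \<zeta>)" for \<eta>
    using Riesz_representation_real [OF bl [of \<eta>]] by blast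
  then obtain s where s: "\<And>\<xi> \<eta>. Re (cinner (blinfun_apply T \<xi>) \<eta>) = Re (cinner \<xi> (s \<eta>))"
    by metis
  have adj: "cinner (blinfun_apply T \<xi>) \<eta> = cinner \<xi> (s \<eta>)" for \<xi> \<eta>
  proof (rule complex_eqI)
    have "Re (\<i> * cinner (blinfun_apply T \<xi>) \<eta>) = Re (\<i> * cinner \<xi> (s \<eta>))"
      using s [of "\<i> *\<^sub>C \<xi>" \<eta>] by (simp only: bounded_ops_scaleC [OF T] cinner_scaleC_left)
    then show "Im (cinner (blinfun_apply T \<xi>) \<eta>) = Im (cinner \<xi> (s \<eta>))"
      by simp
  qed (rule s)
  have adj': "cinner (s \<eta>) \<xi> = cinner \<eta> (blinfun_apply T \<xi>)" for \<xi> \<eta>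
    by (metis adj cinner_commute)
  have add: "s (\<eta> + \<eta>') = s \<eta> + s \<eta>'" for \<eta> \<eta>'
    by (rule cinner_eqI) (simp add: adj' cinner_add_left)
  have scale: "s (c *\<^sub>C \<eta>) = c *\<^sub>C s \<eta>" for c \<eta>
    by (rule cinner_eqI) (simp add: adj' cinner_scaleC_left)
  have "bounded_linear s"
  proof (rule bounded_linear_intro [where K = "norm T"])
    fix \<eta>
    have "norm (s \<eta>) * norm (s \<eta>) = Re (cinner \<eta> (blinfun_apply T (s \<eta>)))"
      unfolding adj' [symmetric] Re_cinner_self power2_eq_square ..
    also have "\<dots> \<le> norm \<eta> * (norm T * norm (s \<eta>))"
      using Re_cinner_le [of \<eta> "blinfun_apply T (s \<eta>)"] norm_blinfun [of T "s \<eta>"]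
      by (meson mult_left_mono norm_ge_zero order_trans)
    finally show "norm (s \<eta>) \<le> norm \<eta> * norm T"
      by (cases "s \<eta> = 0") (simp_all add: mult.assoc [symmetric])
  qed (simp_all add: add scale scaleR_scaleC)
  then have "blinfun_apply (Blinfun s) = s" by (rule bounded_linear_Blinfun_apply)
  then show thesis
    using that [of "Blinfun s"] by (simp add: bounded_ops_def is_adjoint_def scale adj)
qed

section \<open>The commutant of a self-adjoint isometry\<close>

lemma closedin_sot_eq:
  fixes f g :: "('h::complex_hilbert \<Rightarrow>\<^sub>L 'h) \<Rightarrow> 'b::metric_space"
  assumes "continuous_map strong_operator_topology euclidean f"
    and "continuous_map strong_operator_topology euclidean g"
  shows "closedin strong_operator_topology {T. f T = g T}"
proof -
  have "closedin strong_operator_topology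
      {T \<in> topspace strong_operator_topology. f T = g T}"
    by (rule closedin_continuous_maps_eq [OF Hausdorff_space_euclidean assms])
  then show ?thesis by (simp add: strong_operator_topology_topspace)
qed

lemma continuous_map_sot_apply:
  fixes F :: "'h::complex_hilbert \<Rightarrow> 'b::topological_space"
  assumes "continuous_on UNIV F"
  shows "continuous_map strong_operator_topology euclidean (\<lambda>T. F (blinfun_apply T \<xi>))"
  using continuous_map_compose [OF strong_operator_topology_continuous_evaluation [of \<xi>], of euclidean F]
    assms by (simp add: o_def continuous_map_iff_continuous2)

lemma closedin_sot_bounded_ops: "closedin strong_operator_topology (bounded_ops :: ('h::complex_hilbert \<Rightarrow>\<^sub>L 'h) set)"
proof -
  have eq: "bounded_ops = (\<Inter>c. \<Inter>\<xi>. {T::'h \<Rightarrow>\<^sub>L 'h. blinfun_apply T (c *\<^sub>C \<xi>) = c *\<^sub>C blinfun_apply T \<xi>})"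
    by (auto simp: bounded_ops_def)
  show ?thesis
    unfolding eq
    by (intro closedin_INT closedin_sot_eq continuous_map_sot_apply continuous_on_scaleC
        continuous_on_id strong_operator_topology_continuous_evaluation UNIV_not_empty)
qed

lemma closed_eq_dense:
  fixes f g :: "'a::topological_space \<Rightarrow> 'b::t2_space"
  assumes "closure D = UNIV" and "continuous_on UNIV f" and "continuous_on UNIV g"
    and "\<And>x. x \<in> D \<Longrightarrow> f x = g x"
  shows "f x = g x"
proof -
  have "closed {x. f x = g x}"
    using assms(2,3) by (rule closed_Collect_eq)
  then have "closure D \<subseteq> {x. f x = g x}"
    using assms(4) by (intro closure_minimal) auto
  then show ?thesis using assms(1) by auto
qed

lemma continuous_on_blinfun: "continuous_on S (blinfun_apply T)"
  by (rule linear_continuous_on [OF blinfun.bounded_linear_right])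

text \<open>Isometry makes the correspondence \<open>a i \<mapsto> b i\<close> well defined and uniformly continuous. The extension
  exists by completeness.\<close>

lemma isometry_extension:
  fixes a b :: "'i \<Rightarrow> 'h::complex_hilbert"
  assumes dense: "closure (a ` I) = UNIV"
    and iso: "\<And>i j. i \<in> I \<Longrightarrow> j \<in> I \<Longrightarrow> dist (a i) (a j) = dist (b i) (b j)"
  obtains V where "continuous_on UNIV V" and "\<And>i. i \<in> I \<Longrightarrow> V (a i) = b i"
proof -
  define f where "f = b \<circ> inv_into I a"
  have f: "f (a i) = b i" if "i \<in> I" for i
  proof -
    have "inv_into I a (a i) \<in> I" and "a (inv_into I a (a i)) = a i"
      using that by (auto intro: inv_into_into f_inv_into_f)
    then show ?thesis
      using iso [OF _ that, of "inv_into I a (a i)"] by (simp add: f_def)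
  qed
  have "uniformly_continuous_on (a ` I) f"
    unfolding uniformly_continuous_on_def by (auto simp: f iso [symmetric])
  then obtain V where "uniformly_continuous_on (closure (a ` I)) V" "\<And>x. x \<in> a ` I \<Longrightarrow> f x = V x"
    by (rule uniformly_continuous_on_extension_on_closure) blast
  then show thesis
    using that [of V] f dense by (auto simp: uniformly_continuous_imp_continuous)
qed

text \<open>Linearity of such a map follows from symmetry. The operators that commute with it form the von
  Neumann algebras that bound the spin model subfactors from above.\<close>

locale symmetric_map =
  fixes V :: "'h::complex_hilbert \<Rightarrow> 'h"
  assumes continuous: "continuous_on UNIV V"
    and symmetric: "cinner (V \<xi>) \<eta> = cinner \<xi> (V \<eta>)"
begin

lemma add: "V (\<xi> + \<eta>) = V \<xi> + V \<eta>"
  by (rule cinner_eqI) (simp add: symmetric cinner_add_left)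

lemma scaleC: "V (c *\<^sub>C \<xi>) = c *\<^sub>C V \<xi>"
  by (rule cinner_eqI) (simp add: symmetric cinner_scaleC_left)

definition commutant :: "('h \<Rightarrow>\<^sub>L 'h) set" where
  "commutant = {T \<in> bounded_ops. \<forall>\<xi>. blinfun_apply T (V \<xi>) = V (blinfun_apply T \<xi>)}"

text \<open>Closure under adjoints: if \<open>T\<close> commutes with a symmetric \<open>V\<close>, take adjoints in \<open>T V = V T\<close>.\<close>

lemma von_neumann_algebra_commutant: "von_neumann_algebra commutant"
proof -
  have "\<exists>S\<in>commutant. is_adjoint T S" if T: "T \<in> commutant" for T
  proof -
    obtain S where S: "S \<in> bounded_ops" "is_adjoint T S"
      using adjoint_exists T unfolding commutant_def by blast
    have "is_adjoint S T" using S(2) by (rule is_adjoint_sym)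
    then have "blinfun_apply S (V \<xi>) = V (blinfun_apply S \<xi>)" for \<xi>
      using T by (intro cinner_eqI) (simp add: is_adjoint_def symmetric commutant_def)
    then show ?thesis using S by (auto simp: commutant_def)
  qed
  then have "unital_star_subalgebra commutant"
    unfolding unital_star_subalgebra_def
    apply (intro conjI ballI allI)
    subgoal by (auto simp: commutant_def)
    subgoal by (simp add: commutant_def bounded_ops_def)
    subgoal by (simp add: commutant_def bounded_ops_def blinfun.add_left add scaleC_add_right)
    subgoal by (simp add: commutant_def bounded_ops_def)
    subgoal by (simp add: commutant_def bounded_ops_def scaleC_op.rep_eq scaleC scaleC_scaleC mult.commute)
    subgoal by blast
    done
  moreover have "closedin strong_operator_topology commutant"
  proof -
    have eq: "commutant
        = bounded_ops \<inter> (\<Inter>\<xi>. {T. blinfun_apply T (V \<xi>) = V (blinfun_apply T \<xi>)})"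
      by (auto simp: commutant_def)
    show ?thesis
      unfolding eq
      by (intro closedin_Int closedin_sot_bounded_ops closedin_INT closedin_sot_eq
          continuous_map_sot_apply continuous
          strong_operator_topology_continuous_evaluation UNIV_not_empty)
  qed
  ultimately show ?thesis by (simp add: von_neumann_algebra_def)
qed

end

text \<open>Since \<open>b j\<close> is some \<open>a k\<close> with \<open>b k = a j\<close>, symmetry gives \<open>\<langle>b i, b j\<rangle> = \<langle>a i, a j\<rangle>\<close>. So the
  correspondence is isometric and extends to the whole space.\<close>

lemma symmetric_extension:
  fixes a b :: "'i \<Rightarrow> 'h::complex_hilbert"
  assumes dense: "closure (a ` I) = UNIV"
    and sym: "\<And>i j. i \<in> I \<Longrightarrow> j \<in> I \<Longrightarrow> cinner (b i) (a j) = cinner (a i) (b j)"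
    and inv: "\<And>i. i \<in> I \<Longrightarrow> \<exists>j\<in>I. a j = b i \<and> b j = a i"
  obtains V where "symmetric_map V" and "\<And>i. i \<in> I \<Longrightarrow> V (a i) = b i"
proof -
  have inner: "cinner (b i) (b j) = cinner (a i) (a j)" if "i \<in> I" "j \<in> I" for i j
    using sym [OF that(1)] inv [OF that(2)] by metis
  have norm: "(norm (b i))\<^sup>2 = (norm (a i))\<^sup>2" if "i \<in> I" for i
    unfolding Re_cinner_self [symmetric] using inner [OF that that] by simp
  have "dist (a i) (a j) = dist (b i) (b j)" if "i \<in> I" "j \<in> I" for i j
  proof -
    have "(norm (a i - a j))\<^sup>2 = (norm (b i - b j))\<^sup>2"
      unfolding norm_diff_square using that by (simp add: inner norm)
    then show ?thesis by (simp add: dist_norm)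
  qed
  then obtain V where cont: "continuous_on UNIV V" and V: "\<And>i. i \<in> I \<Longrightarrow> V (a i) = b i"
    using isometry_extension [OF dense] by metis
  have "symmetric_map V"
  proof
    fix \<xi> \<eta>
    have half: "cinner (V (a i)) \<eta> = cinner (a i) (V \<eta>)" if "i \<in> I" for i
      by (rule closed_eq_dense [OF dense, of "\<lambda>\<eta>. cinner (V (a i)) \<eta>" "\<lambda>\<eta>. cinner (a i) (V \<eta>)"])
        (use that in \<open>auto intro!: continuous_on_cinner continuous_on_id continuous_on_const cont simp: V sym\<close>)
    show "cinner (V \<xi>) \<eta> = cinner \<xi> (V \<eta>)"
      by (rule closed_eq_dense [OF dense, of "\<lambda>\<xi>. cinner (V \<xi>) \<eta>" "\<lambda>\<xi>. cinner \<xi> (V \<eta>)"])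
        (auto intro!: continuous_on_cinner continuous_on_id continuous_on_const cont simp: half)
  qed (rule cont)
  then show thesis using V by (rule that)
qed

lemma von_neumann_generated_subset:
  assumes "von_neumann_algebra M" and "X \<subseteq> M" shows "von_neumann_generated X \<subseteq> M"
  unfolding von_neumann_generated_def using assms by blast

lemma subset_von_neumann_generated: "X \<subseteq> von_neumann_generated X"
  unfolding von_neumann_generated_def by blast

text \<open>The isomorphism is the inverse of the parametrization \<open>\<delta>\<close>; stated for \<open>\<delta>\<close>, its properties are plain
  equations without membership conditions.\<close>

lemma star_isomorphic_C_plus_C_range:
  fixes \<delta> :: "complex \<Rightarrow> complex \<Rightarrow> 'h::complex_hilbert \<Rightarrow>\<^sub>L 'h"
  assumes bounded: "\<And>a b. \<delta> a b \<in> bounded_ops"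
    and one: "\<delta> 1 1 = id_blinfun"
    and add: "\<And>a b c d. \<delta> a b + \<delta> c d = \<delta> (a + c) (b + d)"
    and mult: "\<And>a b c d. \<delta> a b o\<^sub>L \<delta> c d = \<delta> (a * c) (b * d)"
    and scale: "\<And>k a b. scaleC_op k (\<delta> a b) = \<delta> (k * a) (k * b)"
    and adjoint: "\<And>a b. is_adjoint (\<delta> a b) (\<delta> (cnj a) (cnj b))"
    and inj: "\<And>a b c d. \<delta> a b = \<delta> c d \<Longrightarrow> a = c \<and> b = d"
  shows "star_isomorphic_C_plus_C (range (\<lambda>(a, b). \<delta> a b))"
proof -
  let ?M = "range (\<lambda>(a, b). \<delta> a b)"
  define \<phi> where "\<phi> = inv_into UNIV (\<lambda>(a, b). \<delta> a b)"
  have in_M: "\<delta> a b \<in> ?M" for a b by (rule range_eqI [of _ _ "(a, b)"]) simp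
  have M_E: "\<exists>a b. T = \<delta> a b" if "T \<in> ?M" for T using that by auto
  have inj': "inj (\<lambda>(a, b). \<delta> a b)" using inj by (auto simp: inj_def)
  have \<phi>: "\<phi> (\<delta> a b) = (a, b)" for a b
    unfolding \<phi>_def using inv_f_f [OF inj', of "(a, b)"] by simp
  have alg: "unital_star_subalgebra ?M"
    unfolding unital_star_subalgebra_def
  proof (intro conjI ballI allI)
    show "?M \<subseteq> bounded_ops" using bounded by auto
    show "id_blinfun \<in> ?M" using in_M [of 1 1] by (simp add: one)
    show "\<exists>S\<in>?M. is_adjoint T S" if "T \<in> ?M" for T
      using M_E [OF that] adjoint in_M by blast
    show "S + T \<in> ?M" "S o\<^sub>L T \<in> ?M" if "S \<in> ?M" "T \<in> ?M" for S T
      using M_E [OF that(1)] M_E [OF that(2)] add mult in_M by metis+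
    show "scaleC_op c T \<in> ?M" if "T \<in> ?M" for c T
      using M_E [OF that] scale in_M by metis
  qed
  have bij: "bij_betw \<phi> ?M UNIV"
    unfolding \<phi>_def by (rule bij_betw_inv_into) (simp add: bij_betw_def inj')
  have \<phi>_one: "\<phi> id_blinfun = (1, 1)" by (simp add: one [symmetric] \<phi>)
  have \<phi>_add: "\<phi> (S + T) = (fst (\<phi> S) + fst (\<phi> T), snd (\<phi> S) + snd (\<phi> T))"
    and \<phi>_mult: "\<phi> (S o\<^sub>L T) = (fst (\<phi> S) * fst (\<phi> T), snd (\<phi> S) * snd (\<phi> T))"
    if "S \<in> ?M" "T \<in> ?M" for S T
    using that by (auto simp: add mult \<phi>)
  have \<phi>_scale: "\<phi> (scaleC_op c T) = (c * fst (\<phi> T), c * snd (\<phi> T))" if "T \<in> ?M" for c T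
    using that by (auto simp: scale \<phi>)
  have \<phi>_adjoint: "\<phi> S = (cnj (fst (\<phi> T)), cnj (snd (\<phi> T)))" if T_in: "T \<in> ?M" and S: "is_adjoint T S" for S T
  proof -
    obtain a b where T: "T = \<delta> a b" using M_E [OF T_in] by blast
    then have "S = \<delta> (cnj a) (cnj b)" using S adjoint by (blast intro: adjoint_unique)
    then show ?thesis by (simp add: T \<phi>)
  qed
  show ?thesis
    unfolding star_isomorphic_C_plus_C_def
    by (intro conjI exI [of _ \<phi>] ballI allI impI alg bij \<phi>_one \<phi>_add \<phi>_mult \<phi>_scale \<phi>_adjoint)
qed

section \<open>Kronecker products\<close>

lemma mult_square_carrier [simp]:
  "A \<in> carrier_mat n n \<Longrightarrow> B \<in> carrier_mat n n \<Longrightarrow> A * B \<in> carrier_mat n n"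
  by auto

lemma kron_dim [simp]:
  "dim_row (kron A B) = dim_row A * dim_row B" "dim_col (kron A B) = dim_col A * dim_col B"
  by (simp_all add: kron_def)

lemma kron_carrier [simp]:
  "A \<in> carrier_mat m m \<Longrightarrow> B \<in> carrier_mat n n \<Longrightarrow> kron A B \<in> carrier_mat (m * n) (m * n)"
  by (auto simp: kron_def)

lemma index_kron:
  assumes "i < dim_row A * dim_row B" and "j < dim_col A * dim_col B"
  shows "kron A B $$ (i, j)
    = A $$ (i div dim_row B, j div dim_col B) * B $$ (i mod dim_row B, j mod dim_col B)"
  using assms by (simp add: kron_def)

lemma div_mod_less:
  assumes "i < m * (n::nat)" shows "i div n < m" and "i mod n < n"
  using assms by (auto simp: less_mult_imp_div_less) (metis mod_less_divisor mult_0_right not_gr_zero not_less0)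

text \<open>The digits \<open>k div n\<close> and \<open>k mod n\<close> of \<open>k < m * n\<close> run independently, which is why Kronecker
  products multiply factorwise.\<close>

lemma sum_div_mod:
  fixes f g :: "nat \<Rightarrow> 'a::comm_semiring_1"
  shows "(\<Sum>k<m * n. f (k div n) * g (k mod n)) = (\<Sum>i<m. f i) * (\<Sum>j<n. g j)"
proof (cases "n = 0")
  case False
  have "(\<Sum>k<m * n. f (k div n) * g (k mod n))
      = (\<Sum>i<m. \<Sum>k\<in>{i * n..<i * n + n}. f (k div n) * g (k mod n))"
    by (rule sum.nat_group [symmetric])
  also have "\<dots> = (\<Sum>i<m. \<Sum>j<n. f i * g j)"
  proof (rule sum.cong [OF refl])
    fix i
    have "(\<Sum>k\<in>{i * n..<i * n + n}. f (k div n) * g (k mod n))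
        = (\<Sum>k\<in>{0..<n}. f ((k + i * n) div n) * g ((k + i * n) mod n))"
      using sum.shift_bounds_nat_ivl [of "\<lambda>k. f (k div n) * g (k mod n)" 0 "i * n" n]
      by (simp add: add.commute)
    also have "\<dots> = (\<Sum>j<n. f i * g j)"
      using False by (intro sum.cong) auto
    finally show "(\<Sum>k\<in>{i * n..<i * n + n}. f (k div n) * g (k mod n)) = (\<Sum>j<n. f i * g j)" .
  qed
  also have "\<dots> = (\<Sum>i<m. f i) * (\<Sum>j<n. g j)"
    by (rule sum_product [symmetric])
  finally show ?thesis .
qed simp

lemma index_mult_square:
  assumes "A \<in> carrier_mat n n" and "B \<in> carrier_mat n n" and "i < n" and "j < n"
  shows "(A * B) $$ (i, j) = (\<Sum>k<n. A $$ (i, k) * B $$ (k, j))"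
  using assms by (simp add: scalar_prod_def atLeast0LessThan)

lemma kron_mult:
  assumes A: "A \<in> carrier_mat m m" and C: "C \<in> carrier_mat m m"
    and B: "B \<in> carrier_mat n n" and D: "D \<in> carrier_mat n n"
  shows "kron A B * kron C D = kron (A * C) (B * D)"
proof (rule eq_matI)
  fix i j assume "i < dim_row (kron (A * C) (B * D))" and "j < dim_col (kron (A * C) (B * D))"
  then have i: "i < m * n" and j: "j < m * n" using assms by auto
  note ij = div_mod_less [OF i] div_mod_less [OF j]
  have "(kron A B * kron C D) $$ (i, j) = (\<Sum>k<m * n. kron A B $$ (i, k) * kron C D $$ (k, j))"
    using assms i j by (intro index_mult_square) auto
  also have "\<dots> = (\<Sum>k<m * n. (A $$ (i div n, k div n) * C $$ (k div n, j div n)) *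
      (B $$ (i mod n, k mod n) * D $$ (k mod n, j mod n)))"
    using assms i j by (intro sum.cong) (auto simp: index_kron)
  also have "\<dots> = (A * C) $$ (i div n, j div n) * (B * D) $$ (i mod n, j mod n)"
    unfolding index_mult_square [OF A C ij(1,3)] index_mult_square [OF B D ij(2,4)]
    by (rule sum_div_mod)
  also have "\<dots> = kron (A * C) (B * D) $$ (i, j)"
    using assms i j by (subst index_kron) auto
  finally show "(kron A B * kron C D) $$ (i, j) = kron (A * C) (B * D) $$ (i, j)" .
qed (use assms in auto)

lemma kron_add_left:
  assumes "A \<in> carrier_mat m m" and "C \<in> carrier_mat m m" and "B \<in> carrier_mat n n"
  shows "kron (A + C) B = kron A B + kron C B"
  using assms by (intro eq_matI) (auto simp: index_kron div_mod_less distrib_right)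

lemma kron_add_right:
  assumes "A \<in> carrier_mat m m" and "B \<in> carrier_mat n n" and "D \<in> carrier_mat n n"
  shows "kron A (B + D) = kron A B + kron A D"
  using assms by (intro eq_matI) (auto simp: index_kron div_mod_less distrib_left)

lemma kron_smult_left:
  assumes "A \<in> carrier_mat m m" and "B \<in> carrier_mat n n"
  shows "kron (c \<cdot>\<^sub>m A) B = c \<cdot>\<^sub>m kron A B"
  using assms by (intro eq_matI) (auto simp: index_kron div_mod_less)

lemma kron_zero_left:
  assumes "B \<in> carrier_mat n n"
  shows "kron (0\<^sub>m m m) B = 0\<^sub>m (m * n) (m * n)"
  using assms by (intro eq_matI) (auto simp: index_kron div_mod_less)

lemma kron_one: "kron (1\<^sub>m m) (1\<^sub>m n) = 1\<^sub>m (m * n)"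
proof (rule eq_matI)
  fix i j assume "i < dim_row (1\<^sub>m (m * n)::complex mat)" and "j < dim_col (1\<^sub>m (m * n)::complex mat)"
  then have ij: "i < m * n" "j < m * n" by auto
  have "i = j \<longleftrightarrow> i div n = j div n \<and> i mod n = j mod n"
    by (metis div_mult_mod_eq)
  then show "kron (1\<^sub>m m) (1\<^sub>m n) $$ (i, j) = 1\<^sub>m (m * n) $$ (i, j)"
    using ij div_mod_less [OF ij(1)] div_mod_less [OF ij(2)] by (simp add: index_kron)
qed auto

lemma index_mat_adjoint:
  assumes "A \<in> carrier_mat n n" and "i < n" and "j < n"
  shows "mat_adjoint A $$ (i, j) = cnj (A $$ (j, i))"
  using assms by (simp add: mat_adjoint_def mat_of_rows_def)

lemma mat_adjoint_dim [simp]: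
  "dim_row (mat_adjoint A) = dim_col A" "dim_col (mat_adjoint A) = dim_row A"
  by (simp_all add: mat_adjoint_def)

lemma mat_adjoint_carrier [simp]: "A \<in> carrier_mat n n \<Longrightarrow> mat_adjoint A \<in> carrier_mat n n"
  by (auto intro!: carrier_matI)

lemma mat_adjoint_kron:
  fixes A B :: "complex mat"
  assumes A: "A \<in> carrier_mat m m" and B: "B \<in> carrier_mat n n"
  shows "mat_adjoint (kron A B) = kron (mat_adjoint A) (mat_adjoint B)"
proof (rule eq_matI)
  fix i j assume "i < dim_row (kron (mat_adjoint A) (mat_adjoint B))"
    and "j < dim_col (kron (mat_adjoint A) (mat_adjoint B))"
  then have ij: "i < m * n" "j < m * n" using A B by auto
  then show "mat_adjoint (kron A B) $$ (i, j) = kron (mat_adjoint A) (mat_adjoint B) $$ (i, j)"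
    using ij div_mod_less [OF ij(1)] div_mod_less [OF ij(2)] A B
    by (simp add: index_mat_adjoint [OF kron_carrier [OF A B]] index_kron
        index_mat_adjoint [OF A] index_mat_adjoint [OF B])
qed (use A B in auto)

section \<open>Two by two matrices\<close>

lemma mat2_eqI:
  assumes "A \<in> carrier_mat 2 2" and "B \<in> carrier_mat 2 2"
    and "A $$ (0, 0) = B $$ (0, 0)" and "A $$ (0, 1) = B $$ (0, 1)"
    and "A $$ (1, 0) = B $$ (1, 0)" and "A $$ (1, 1) = B $$ (1, 1)"
  shows "A = B"
proof (rule eq_matI)
  fix i j assume "i < dim_row B" and "j < dim_col B"
  then have "(i = 0 \<or> i = 1) \<and> (j = 0 \<or> j = 1)" using assms(2) by auto
  then show "A $$ (i, j) = B $$ (i, j)" using assms by auto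
qed (use assms in auto)

lemma index_mult_mat2:
  assumes "A \<in> carrier_mat 2 2" and "B \<in> carrier_mat 2 2" and "i < 2" and "j < 2"
  shows "(A * B) $$ (i, j) = A $$ (i, 0) * B $$ (0, j) + A $$ (i, 1) * B $$ (1, j)"
  by (simp add: index_mult_square [OF assms] numeral_2_eq_2)

lemma matrix_unit_carrier [simp]: "matrix_unit n i j \<in> carrier_mat n n"
  by (simp add: matrix_unit_def)

lemma matrix_unit_dim [simp]: "dim_row (matrix_unit n i j) = n" "dim_col (matrix_unit n i j) = n"
  by (simp_all add: matrix_unit_def)

lemma index_matrix_unit [simp]:
  "r < n \<Longrightarrow> c < n \<Longrightarrow> matrix_unit n i j $$ (r, c) = (if r = i \<and> c = j then 1 else 0)"
  by (simp add: matrix_unit_def)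

lemma matrix_unit_mult:
  assumes "j < n" and "k < n"
  shows "matrix_unit n i j * matrix_unit n k l = (if j = k then matrix_unit n i l else 0\<^sub>m n n)"
proof (rule eq_matI)
  fix r c assume "r < dim_row (if j = k then matrix_unit n i l else 0\<^sub>m n n)"
    and "c < dim_col (if j = k then matrix_unit n i l else 0\<^sub>m n n)"
  then have rc: "r < n" "c < n" by (auto simp: matrix_unit_def split: if_splits)
  have "(matrix_unit n i j * matrix_unit n k l) $$ (r, c)
      = (\<Sum>s<n. if s = j then (if r = i \<and> j = k \<and> c = l then 1 else 0) else 0)"
    unfolding index_mult_square [OF matrix_unit_carrier matrix_unit_carrier rc]
    using rc by (intro sum.cong) auto
  then show "(matrix_unit n i j * matrix_unit n k l) $$ (r, c)
      = (if j = k then matrix_unit n i l else 0\<^sub>m n n) $$ (r, c)"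
    using rc assms by simp
qed (simp_all add: matrix_unit_def)

lemma J_mat_carrier [simp]: "J_mat n \<in> carrier_mat n n"
  by (simp add: J_mat_def)

lemma J_mat_dim [simp]: "dim_row (J_mat n) = n" "dim_col (J_mat n) = n"
  by (simp_all add: J_mat_def)

lemma index_J_mat:
  assumes "r < n" and "c < n"
  shows "J_mat n $$ (r, c) = 1 / of_nat n"
proof -
  have "(\<Sum>i<n. \<Sum>j<n. matrix_unit n i j $$ (r, c) / of_nat n)
      = (\<Sum>i<n. \<Sum>j<n. if j = c then (if i = r then 1 / of_nat n else 0) else (0::complex))"
    using assms by (intro sum.cong refl) auto
  then show ?thesis using assms by (simp add: J_mat_def)
qed

section \<open>Flips and the symmetry of the tower\<close>

text \<open>The self-adjoint unitary \<open>u D u\<^sup>*\<close> with \<open>D = diag(1,-1)\<close> and \<open>u\<close> the Hadamard matrix with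
  parameter \<open>\<alpha>\<close>. For \<open>\<alpha> = 0\<close> it is the flip of the two basis vectors.\<close>

definition flip :: "real \<Rightarrow> complex mat" where
  "flip \<alpha> = mat 2 2 (\<lambda>(r, c). if r = c then 0 else if r = 0 then exp (- (\<i> * \<alpha>)) else exp (\<i> * \<alpha>))"

lemma flip_carrier [simp]: "flip \<alpha> \<in> carrier_mat 2 2"
  by (simp add: flip_def)

lemma index_flip [simp]:
  "flip \<alpha> $$ (0, 0) = 0" "flip \<alpha> $$ (0, Suc 0) = exp (- (\<i> * \<alpha>))"
  "flip \<alpha> $$ (Suc 0, 0) = exp (\<i> * \<alpha>)" "flip \<alpha> $$ (Suc 0, Suc 0) = 0"
  by (simp_all add: flip_def)

lemma flip_flip: "flip \<alpha> * flip \<alpha> = 1\<^sub>m 2"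
  by (rule mat2_eqI)
    (simp_all add: index_mult_mat2 mult_exp_exp del: index_mult_mat(1))

lemma mat_adjoint_flip: "mat_adjoint (flip \<alpha>) = flip \<alpha>"
  by (rule mat2_eqI) (simp_all add: index_mat_adjoint [of _ 2] exp_cnj)

lemma flip_matrix_unit_0: "flip \<alpha> * matrix_unit 2 0 0 = matrix_unit 2 1 1 * flip \<alpha>"
  by (rule mat2_eqI) (simp_all add: index_mult_mat2 del: index_mult_mat(1))

lemma flip_matrix_unit_1: "flip \<alpha> * matrix_unit 2 1 1 = matrix_unit 2 0 0 * flip \<alpha>"
  by (rule mat2_eqI) (simp_all add: index_mult_mat2 del: index_mult_mat(1))

lemma flip_J_mat: "flip 0 * J_mat 2 = J_mat 2 * flip 0"
  by (rule mat2_eqI) (simp_all add: index_mult_mat2 index_J_mat del: index_mult_mat(1))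

text \<open>The size of the matrices in the tensor power with factors \<open>0, \<dots>, m\<close>. A constant of its own keeps
  arithmetic simplification from hiding the recursive structure of the powers of two.\<close>

definition tsize :: "nat \<Rightarrow> nat" where
  "tsize m = 2 * 2 ^ m"

lemma tsize_0 [simp]: "tsize 0 = 2" and tsize_Suc: "tsize (Suc m) = 2 * tsize m"
  by (simp_all add: tsize_def)

lemma power2_Suc_eq_tsize: "2 ^ Suc m = tsize m"
  by (simp add: tsize_def)

abbreviation M :: "nat \<Rightarrow> complex mat set" where
  "M m \<equiv> carrier_mat (tsize m) (tsize m)"

lemma kron_M [simp]: "A \<in> carrier_mat 2 2 \<Longrightarrow> B \<in> M m \<Longrightarrow> kron A B \<in> M (Suc m)"
  by (simp add: tsize_Suc)

text \<open>The restrictions to the finite tensor powers of the symmetry that fixes the spin model subfactor: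
  conjugation by \<open>X \<otimes> \<dots> \<otimes> X \<otimes> flip \<alpha>\<close>, where \<open>X = flip 0\<close>.\<close>

fun flip_string :: "real \<Rightarrow> nat \<Rightarrow> complex mat" where
  "flip_string \<alpha> 0 = flip \<alpha>"
| "flip_string \<alpha> (Suc m) = kron (flip 0) (flip_string \<alpha> m)"

lemma flip_string_carrier [simp]: "flip_string \<alpha> m \<in> M m"
  by (induction m) simp_all

lemma flip_string_flip_string: "flip_string \<alpha> m * flip_string \<alpha> m = 1\<^sub>m (tsize m)"
proof (induction m)
  case (Suc m)
  then show ?case
    by (simp add: kron_mult [OF flip_carrier flip_carrier flip_string_carrier flip_string_carrier]
        flip_flip kron_one tsize_Suc)
qed (simp add: flip_flip)

lemma mat_adjoint_flip_string: "mat_adjoint (flip_string \<alpha> m) = flip_string \<alpha> m"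
proof (induction m)
  case (Suc m)
  then show ?case
    by (simp add: mat_adjoint_kron [OF flip_carrier flip_string_carrier] mat_adjoint_flip)
qed (simp add: mat_adjoint_flip)

text \<open>The iterated inclusion \<open>x \<mapsto> 1 \<otimes> \<dots> \<otimes> 1 \<otimes> x\<close> into the algebra \<open>k\<close> tensor factors further up.\<close>

fun lift :: "nat \<Rightarrow> complex mat \<Rightarrow> complex mat" where
  "lift 0 a = a"
| "lift (Suc m) a = kron (1\<^sub>m 2) (lift m a)"

lemma lift_carrier: "a \<in> M m \<Longrightarrow> lift k a \<in> M (m + k)"
  by (induction k) simp_all

lemma lift_carrier_0 [simp]: "a \<in> carrier_mat 2 2 \<Longrightarrow> lift m a \<in> M m"
  using lift_carrier [of a 0 m] by simp

lemma lift_mult: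
  assumes "a \<in> M m" and "b \<in> M m"
  shows "lift k (a * b) = lift k a * lift k b"
proof (induction k)
  case (Suc k)
  then show ?case
    by (simp add: kron_mult [OF one_carrier_mat one_carrier_mat
        lift_carrier [OF assms(1)] lift_carrier [OF assms(2)]])
qed simp

lemma lift_one: "lift m (1\<^sub>m 2) = 1\<^sub>m (tsize m)"
  by (induction m) (simp_all add: kron_one tsize_Suc)

lemma mat_adjoint_one: "mat_adjoint (1\<^sub>m n :: complex mat) = 1\<^sub>m n"
  by (rule eq_matI) (auto simp: index_mat_adjoint [OF one_carrier_mat])

lemma mat_adjoint_lift:
  assumes "a \<in> carrier_mat 2 2"
  shows "mat_adjoint (lift m a) = lift m (mat_adjoint a)"
proof (induction m)
  case (Suc m)
  then show ?case
    using assms by (simp add: mat_adjoint_kron [OF one_carrier_mat lift_carrier_0] mat_adjoint_one)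
qed simp

lemma flip_string_lift_commute:
  assumes c: "c \<in> M m" and "flip_string \<alpha> m * c = c * flip_string \<alpha> m"
  shows "flip_string \<alpha> (m + k) * lift k c = lift k c * flip_string \<alpha> (m + k)"
proof (induction k)
  case (Suc k)
  then show ?case
    using lift_carrier [OF c, of k]
    by (simp add: kron_mult [OF flip_carrier one_carrier_mat flip_string_carrier]
        kron_mult [OF one_carrier_mat flip_carrier _ flip_string_carrier]
        left_mult_one_mat [OF flip_carrier] right_mult_one_mat [OF flip_carrier])
qed (simp add: assms)

text \<open>All tensor factors except the rightmost one contribute \<open>X * X = 1\<close>. So the conjugations for \<open>\<alpha>\<close>
  and \<open>\<beta>\<close> differ by a conjugation in the rightmost factor alone.\<close>

lemma flip_string_mult:
  "flip_string \<alpha> m * flip_string \<beta> m = lift m (flip \<alpha> * flip \<beta>)"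
proof (induction m)
  case (Suc m)
  then show ?case
    by (simp add: kron_mult [OF flip_carrier flip_carrier flip_string_carrier flip_string_carrier]
        flip_flip)
qed simp

text \<open>The diagonal projections of the leftmost tensor factor of \<open>M m\<close>.\<close>

definition corner :: "nat \<Rightarrow> nat \<Rightarrow> complex mat" where
  "corner m i = kron (matrix_unit 2 i i) (1\<^sub>m (2 ^ m))"

lemma corner_carrier [simp]: "corner m i \<in> M m"
  by (simp add: corner_def tsize_def)

lemma corner_0: "corner 0 i = matrix_unit 2 i i"
  unfolding corner_def by (rule mat2_eqI) (auto simp: index_kron intro!: carrier_matI)

lemma matrix_unit_2_sum: "matrix_unit 2 0 0 + matrix_unit 2 1 1 = 1\<^sub>m 2"
  by (rule mat2_eqI) simp_all

lemma corner_sum: "corner m 0 + corner m 1 = 1\<^sub>m (tsize m)"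
  unfolding corner_def
  by (simp only: kron_add_left [OF matrix_unit_carrier matrix_unit_carrier one_carrier_mat, symmetric]
      matrix_unit_2_sum kron_one tsize_def)

lemma flip_string_corner_0: "flip_string \<alpha> m * corner m 0 = corner m 1 * flip_string \<alpha> m"
proof (cases m)
  case (Suc l)
  show ?thesis
    unfolding Suc corner_def flip_string.simps power2_Suc_eq_tsize
    by (simp only: kron_mult [OF flip_carrier matrix_unit_carrier flip_string_carrier one_carrier_mat]
        kron_mult [OF matrix_unit_carrier flip_carrier one_carrier_mat flip_string_carrier] flip_matrix_unit_0 left_mult_one_mat [OF flip_string_carrier] right_mult_one_mat [OF flip_string_carrier])
qed (simp add: corner_0 flip_matrix_unit_0)

lemma flip_string_corner_1: "flip_string \<alpha> m * corner m 1 = corner m 0 * flip_string \<alpha> m"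
proof (cases m)
  case (Suc l)
  show ?thesis
    unfolding Suc corner_def flip_string.simps power2_Suc_eq_tsize
    by (simp only: kron_mult [OF flip_carrier matrix_unit_carrier flip_string_carrier one_carrier_mat]
        kron_mult [OF matrix_unit_carrier flip_carrier one_carrier_mat flip_string_carrier] flip_matrix_unit_1 left_mult_one_mat [OF flip_string_carrier] right_mult_one_mat [OF flip_string_carrier])
qed (use flip_matrix_unit_1 in \<open>simp add: corner_0\<close>)

section \<open>The Jones projections\<close>

lemma jones_projection_even: "jones_projection 2 (2 * m) = kron (J_mat 2) (1\<^sub>m (2 ^ m))"
  by (simp add: jones_projection_def)

text \<open>Both sides are the diagonal projection onto the basis vectors whose two leading binary digits
  agree. The right-hand side separates the new leftmost factor from the algebra \<open>M m\<close>.\<close>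

lemma jones_projection_odd:
  "jones_projection 2 (2 * m + 1)
    = kron (matrix_unit 2 0 0) (corner m 0) + kron (matrix_unit 2 1 1) (corner m 1)"
proof (rule eq_matI)
  let ?N = "2 ^ m :: nat"
  have dj: "diag_jones 2 \<in> carrier_mat 4 4" by (simp add: diag_jones_def)
  fix r c assume "r < dim_row (kron (matrix_unit 2 0 0) (corner m 0) + kron (matrix_unit 2 1 1) (corner m 1))"
    and "c < dim_col (kron (matrix_unit 2 0 0) (corner m 0) + kron (matrix_unit 2 1 1) (corner m 1))"
  then have rc: "r < 2 * (2 * ?N)" "c < 2 * (2 * ?N)" by (auto simp: corner_def matrix_unit_def)
  then have rc': "r < (2 * 2) * ?N" "c < (2 * 2) * ?N" by simp_all
  \<comment> \<open>\<open>jones_projection\<close> groups the three factors as \<open>(2 * 2) * N\<close>, the claim as \<open>2 * (2 * N)\<close>.\<close>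
  note less = div_mod_less [OF rc(1)] div_mod_less [OF rc(2)]
    div_mod_less [OF rc'(1)] div_mod_less [OF rc'(2)]
    div_mod_less [OF div_mod_less(1) [OF rc'(1)]] div_mod_less [OF div_mod_less(1) [OF rc'(2)]]
    div_mod_less [OF div_mod_less(2) [OF rc(1)]] div_mod_less [OF div_mod_less(2) [OF rc(2)]]
  have digits: "t div ?N div 2 = t div (2 * ?N)" "t div ?N mod 2 = t mod (2 * ?N) div ?N"
    "t mod (2 * ?N) mod ?N = t mod ?N" for t
    by (simp_all add: div_mult2_eq mod_mult2_eq mult.commute [of 2] mod_mod_cancel)
  have u: "kron (matrix_unit 2 i i) (matrix_unit 2 i i) $$ (r div ?N, c div ?N)
      = matrix_unit 2 i i $$ (r div ?N div 2, c div ?N div 2)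
      * matrix_unit 2 i i $$ (r div ?N mod 2, c div ?N mod 2)" for i
    using less by (subst index_kron) (simp_all add: matrix_unit_def)
  have v: "kron (matrix_unit 2 i i) (corner m i) $$ (r, c)
      = matrix_unit 2 i i $$ (r div (2 * ?N), c div (2 * ?N))
      * (matrix_unit 2 i i $$ (r mod (2 * ?N) div ?N, c mod (2 * ?N) div ?N)
      * 1\<^sub>m ?N $$ (r mod (2 * ?N) mod ?N, c mod (2 * ?N) mod ?N))" for i
    using rc less unfolding corner_def by (simp add: index_kron matrix_unit_def)
  have "jones_projection 2 (2 * m + 1) $$ (r, c)
      = diag_jones 2 $$ (r div ?N, c div ?N) * 1\<^sub>m ?N $$ (r mod ?N, c mod ?N)"
    using rc' dj by (simp add: jones_projection_def index_kron)
  also have "diag_jones 2 $$ (r div ?N, c div ?N)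
      = (\<Sum>i<2. kron (matrix_unit 2 i i) (matrix_unit 2 i i) $$ (r div ?N, c div ?N))"
    using less by (simp add: diag_jones_def)
  also have "\<dots> * 1\<^sub>m ?N $$ (r mod ?N, c mod ?N)
      = kron (matrix_unit 2 0 0) (corner m 0) $$ (r, c) + kron (matrix_unit 2 1 1) (corner m 1) $$ (r, c)"
    unfolding u v digits by (simp add: numeral_2_eq_2 distrib_right mult.assoc)
  finally show "jones_projection 2 (2 * m + 1) $$ (r, c)
      = (kron (matrix_unit 2 0 0) (corner m 0) + kron (matrix_unit 2 1 1) (corner m 1)) $$ (r, c)"
    using rc by (simp add: corner_def matrix_unit_def)
qed (simp_all add: jones_projection_def corner_def matrix_unit_def diag_jones_def)

lemma jones_projection_even_carrier [simp]: "jones_projection 2 (2 * m) \<in> M m"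
  by (simp add: jones_projection_even tsize_def)

lemma jones_projection_odd_carrier [simp]: "jones_projection 2 (2 * m + 1) \<in> M (Suc m)"
  unfolding jones_projection_odd by simp

lemma mat_adjoint_matrix_unit_diag: "mat_adjoint (matrix_unit n i i) = matrix_unit n i i"
  by (rule eq_matI) (auto simp: index_mat_adjoint [OF matrix_unit_carrier])

lemma mat_adjoint_add:
  fixes A B :: "complex mat"
  assumes "A \<in> carrier_mat n n" and "B \<in> carrier_mat n n"
  shows "mat_adjoint (A + B) = mat_adjoint A + mat_adjoint B"
  using assms by (intro eq_matI) (auto simp: index_mat_adjoint [of _ n])

lemma mat_adjoint_jones_even: "mat_adjoint (jones_projection 2 (2 * m)) = jones_projection 2 (2 * m)"
proof -
  have "mat_adjoint (J_mat 2) = J_mat 2"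
    by (rule eq_matI) (auto simp: index_mat_adjoint [OF J_mat_carrier] index_J_mat)
  then show ?thesis
    unfolding jones_projection_even
    by (simp add: mat_adjoint_kron [OF J_mat_carrier one_carrier_mat] mat_adjoint_one)
qed

lemma mat_adjoint_jones_odd:
  "mat_adjoint (jones_projection 2 (2 * m + 1)) = jones_projection 2 (2 * m + 1)"
proof -
  have "mat_adjoint (corner m i) = corner m i" for i
    unfolding corner_def
    by (simp add: mat_adjoint_kron [OF matrix_unit_carrier one_carrier_mat] mat_adjoint_one
        mat_adjoint_matrix_unit_diag)
  then show ?thesis
    unfolding jones_projection_odd
    by (simp add: mat_adjoint_add [of _ "tsize (Suc m)"]
        mat_adjoint_kron [OF matrix_unit_carrier corner_carrier] mat_adjoint_matrix_unit_diag)
qed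

text \<open>The symmetries fix the Jones projections: \<open>X\<close> commutes with \<open>J\<close>, and on the odd projections the
  two flips of neighbouring factors exchange both summands. The even projection of index 0, which lives
  in the factor where \<open>flip \<alpha>\<close> acts, is excluded.\<close>

lemma flip_string_jones_even:
  "flip_string \<alpha> (Suc m) * jones_projection 2 (2 * Suc m)
    = jones_projection 2 (2 * Suc m) * flip_string \<alpha> (Suc m)"
proof -
  show ?thesis
    unfolding jones_projection_even flip_string.simps power2_Suc_eq_tsize
    by (simp only: kron_mult [OF flip_carrier J_mat_carrier flip_string_carrier one_carrier_mat]
        kron_mult [OF J_mat_carrier flip_carrier one_carrier_mat flip_string_carrier] flip_J_mat left_mult_one_mat [OF flip_string_carrier] right_mult_one_mat [OF flip_string_carrier])
qed

lemma flip_string_jones_odd: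
  "flip_string \<alpha> (Suc m) * jones_projection 2 (2 * m + 1)
    = jones_projection 2 (2 * m + 1) * flip_string \<alpha> (Suc m)"
proof -
  have c: "kron (matrix_unit 2 i i) (corner m i) \<in> M (Suc m)" for i
    by simp
  have L: "flip_string \<alpha> (Suc m) * kron (matrix_unit 2 i i) (corner m i)
      = kron (flip 0 * matrix_unit 2 i i) (flip_string \<alpha> m * corner m i)" for i
    unfolding flip_string.simps
    by (rule kron_mult [OF flip_carrier matrix_unit_carrier flip_string_carrier corner_carrier])
  have R: "kron (matrix_unit 2 i i) (corner m i) * flip_string \<alpha> (Suc m)
      = kron (matrix_unit 2 i i * flip 0) (corner m i * flip_string \<alpha> m)" for i
    unfolding flip_string.simps
    by (rule kron_mult [OF matrix_unit_carrier flip_carrier corner_carrier flip_string_carrier])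
  show ?thesis
    unfolding jones_projection_odd mult_add_distrib_mat [OF flip_string_carrier c c]
      add_mult_distrib_mat [OF c c flip_string_carrier] L R
    unfolding flip_matrix_unit_0 flip_matrix_unit_1 flip_string_corner_0 flip_string_corner_1
    by (rule comm_add_mat [of _ "tsize (Suc m)" "tsize (Suc m)"]) simp_all
qed

section \<open>The Hadamard matrices\<close>

lemma hadamard2_carrier [simp]: "hadamard2 \<alpha> \<in> carrier_mat 2 2"
  by (rule carrier_matI) (simp_all add: hadamard2_def mat_of_rows_list_def)

lemma index_hadamard2:
  "hadamard2 \<alpha> $$ (0, 0) = 1 / sqrt 2" "hadamard2 \<alpha> $$ (0, Suc 0) = 1 / sqrt 2"
  "hadamard2 \<alpha> $$ (Suc 0, 0) = exp (\<i> * \<alpha>) / sqrt 2"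
  "hadamard2 \<alpha> $$ (Suc 0, Suc 0) = - exp (\<i> * \<alpha>) / sqrt 2"
  by (simp_all add: hadamard2_def mat_of_rows_list_def)

text \<open>Both factors belong to the commutative algebra \<open>u \<Delta> u\<^sup>*\<close>.\<close>

lemma flip_commutes_conjugated_diagonal:
  assumes "d \<in> diag_alg 2"
  shows "flip \<alpha> * (hadamard2 \<alpha> * d * mat_adjoint (hadamard2 \<alpha>))
    = hadamard2 \<alpha> * d * mat_adjoint (hadamard2 \<alpha>) * flip \<alpha>"
proof -
  have d: "d \<in> carrier_mat 2 2" and off: "d $$ (0, Suc 0) = 0" "d $$ (Suc 0, 0) = 0"
    using assms by (auto simp: diag_alg_def diagonal_mat_def)
  have e: "exp (\<i> * \<alpha>) * exp (- (\<i> * \<alpha>)) = 1" by (simp add: mult_exp_exp)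
  show ?thesis
    by (rule mat2_eqI)
      (simp_all add: index_mult_mat2 index_mat_adjoint [of _ 2] index_hadamard2 d off exp_cnj
        del: index_mult_mat(1), simp_all add: algebra_simps e)
qed

lemma flip_mult_flip:
  "flip \<alpha> * flip \<beta>
    = exp (\<i> * (\<beta> - \<alpha>)) \<cdot>\<^sub>m matrix_unit 2 0 0 + exp (- (\<i> * (\<beta> - \<alpha>))) \<cdot>\<^sub>m matrix_unit 2 1 1"
  by (rule mat2_eqI)
    (simp_all add: index_mult_mat2 mult_exp_exp algebra_simps del: index_mult_mat(1))

section \<open>Functionals that the Jones projections centralize\<close>

lemma block_decomposition:
  assumes b: "b \<in> M (Suc m)"
  obtains p q r s where "p \<in> M m" "q \<in> M m" "r \<in> M m" "s \<in> M m"
    and "b = kron (matrix_unit 2 0 0) p + kron (matrix_unit 2 0 1) q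
      + (kron (matrix_unit 2 1 0) r + kron (matrix_unit 2 1 1) s)"
proof -
  define n where "n = tsize m"
  define B where "B i j = mat n n (\<lambda>(r, c). b $$ (i * n + r, j * n + c))" for i j
  have B: "B i j \<in> carrier_mat n n" for i j by (simp add: B_def)
  have dims: "dim_row (B i j) = n" "dim_col (B i j) = n" for i j by (simp_all add: B_def)
  have b': "dim_row b = 2 * n" "dim_col b = 2 * n" using b by (auto simp: n_def tsize_Suc)
  have "b = kron (matrix_unit 2 0 0) (B 0 0) + kron (matrix_unit 2 0 1) (B 0 1)
      + (kron (matrix_unit 2 1 0) (B 1 0) + kron (matrix_unit 2 1 1) (B 1 1))" (is "_ = ?R")
  proof (rule eq_matI)
    fix r c assume "r < dim_row ?R" and "c < dim_col ?R"
    then have rc: "r < 2 * n" "c < 2 * n" by (auto simp: dims)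
    note less = div_mod_less [OF rc(1)] div_mod_less [OF rc(2)]
    have block: "kron (matrix_unit 2 i j) (B i j) $$ (r, c)
        = (if r div n = i \<and> c div n = j then b $$ (r, c) else 0)" for i j
      using less rc div_mult_mod_eq [of r n] div_mult_mod_eq [of c n]
      by (auto simp: index_kron dims B_def simp del: div_mult_mod_eq)
    have "(r div n = 0 \<or> r div n = 1) \<and> (c div n = 0 \<or> c div n = 1)"
      using less by linarith
    then show "b $$ (r, c) = ?R $$ (r, c)"
      using rc by (auto simp: dims block simp del: One_nat_def)
  qed (simp_all add: b' dims)
  then show thesis
    by (rule that [OF B [unfolded n_def] B [unfolded n_def] B [unfolded n_def] B [unfolded n_def]])
qed

text \<open>A compatible family of linear functionals on the tower that the Jones projections centralize
  is determined by its values on the two minimal projections of the diagonal subalgebra of \<open>M 0\<close>.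
  The odd Jones projections, which couple two neighbouring tensor factors diagonally, show that the
  functional on \<open>M m\<close> is centralized by the diagonal matrices of its leftmost factor. Hence it
  vanishes on the off-diagonal blocks, the even projections make it agree on the two diagonal blocks,
  and so it is determined by its restriction to the previous algebra.\<close>

lemma centralized_functional_zero:
  fixes f :: "nat \<Rightarrow> complex mat \<Rightarrow> complex"
  assumes add: "\<And>m x y. x \<in> M m \<Longrightarrow> y \<in> M m \<Longrightarrow> f m (x + y) = f m x + f m y"
    and smult: "\<And>m c x. x \<in> M m \<Longrightarrow> f m (c \<cdot>\<^sub>m x) = c * f m x"
    and incl: "\<And>m x. x \<in> M m \<Longrightarrow> f (Suc m) (kron (1\<^sub>m 2) x) = f m x"
    and odd: "\<And>m x. x \<in> M (Suc m) \<Longrightarrow>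
      f (Suc m) (jones_projection 2 (2 * m + 1) * x) = f (Suc m) (x * jones_projection 2 (2 * m + 1))"
    and even: "\<And>m x. x \<in> M (Suc m) \<Longrightarrow>
      f (Suc m) (jones_projection 2 (2 * Suc m) * x) = f (Suc m) (x * jones_projection 2 (2 * Suc m))"
    and base: "f 0 (matrix_unit 2 0 0) = 0" "f 0 (matrix_unit 2 1 1) = 0"
    and b: "b \<in> M m"
  shows "f m b = 0"
proof -
  let ?E = "matrix_unit 2"
  note E = matrix_unit_carrier [of 2]
  have split: "f (Suc m) (kron (?E 0 0) x) + f (Suc m) (kron (?E 1 1) x) = f m x" if "x \<in> M m" for m x
  proof -
    have "f m x = f (Suc m) (kron (?E 0 0 + ?E 1 1) x)"
      using incl [OF that] by (simp only: matrix_unit_2_sum)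
    also have "kron (?E 0 0 + ?E 1 1) x = kron (?E 0 0) x + kron (?E 1 1) x"
      by (rule kron_add_left [OF E E that])
    finally show ?thesis using that by (simp add: add)
  qed
  have zero: "f m (0\<^sub>m (tsize m) (tsize m)) = 0" for m
    using add [of "0\<^sub>m (tsize m) (tsize m)" m "0\<^sub>m (tsize m) (tsize m)"] by simp
  have diag: "f m (corner m 0 * x) = f m (x * corner m 0)" if x: "x \<in> M m" for m x
  proof -
    have K: "kron (?E i j) y \<in> M (Suc m)" if "y \<in> M m" for i j y
      using that by simp
    have left: "jones_projection 2 (2 * m + 1) * kron (?E i i) x = kron (?E i i) (corner m i * x)"
      if "i = 0 \<or> i = 1" for i
      unfolding jones_projection_odd add_mult_distrib_mat [OF K [OF corner_carrier] K [OF corner_carrier] K [OF x]]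
        kron_mult [OF E E corner_carrier x]
      using that x by (auto simp: matrix_unit_mult kron_zero_left [of _ "tsize m"] simp flip: tsize_Suc)
    have right: "kron (?E i i) x * jones_projection 2 (2 * m + 1) = kron (?E i i) (x * corner m i)"
      if "i = 0 \<or> i = 1" for i
      unfolding jones_projection_odd mult_add_distrib_mat [OF K [OF x] K [OF corner_carrier] K [OF corner_carrier]]
        kron_mult [OF E E x corner_carrier]
      using that x by (auto simp: matrix_unit_mult kron_zero_left [of _ "tsize m"] simp flip: tsize_Suc)
    have ij: "f (Suc m) (kron (?E i i) (corner m i * x)) = f (Suc m) (kron (?E i i) (x * corner m i))"
      if "i = 0 \<or> i = 1" for i
      using odd [OF K [OF x, of i i]] unfolding left [OF that] right [OF that] .
    have "kron (?E 1 1) x = kron (?E 1 1) ((corner m 0 + corner m 1) * x)"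
      unfolding corner_sum using x by simp
    also have "\<dots> = kron (?E 1 1) (corner m 0 * x) + kron (?E 1 1) (corner m 1 * x)"
      using x by (subst add_mult_distrib_mat [of _ "tsize m" "tsize m"])
        (simp_all add: kron_add_right [of _ 2 _ "tsize m"])
    finally have 1: "f (Suc m) (kron (?E 1 1) x)
        = f (Suc m) (kron (?E 1 1) (corner m 0 * x)) + f (Suc m) (kron (?E 1 1) (corner m 1 * x))"
      using x by (simp add: add)
    have "kron (?E 1 1) x = kron (?E 1 1) (x * (corner m 0 + corner m 1))"
      unfolding corner_sum using x by simp
    also have "\<dots> = kron (?E 1 1) (x * corner m 0) + kron (?E 1 1) (x * corner m 1)"
      using x by (subst mult_add_distrib_mat [of _ "tsize m" "tsize m" _ "tsize m"])
        (simp_all add: kron_add_right [of _ 2 _ "tsize m"])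
    finally have 2: "f (Suc m) (kron (?E 1 1) x)
        = f (Suc m) (kron (?E 1 1) (x * corner m 0)) + f (Suc m) (kron (?E 1 1) (x * corner m 1))"
      using x by (simp add: add)
    have "f (Suc m) (kron (?E 1 1) (corner m 0 * x)) = f (Suc m) (kron (?E 1 1) (x * corner m 0))"
      using 1 2 ij [of 1] by simp
    then show ?thesis
      using split [of "corner m 0 * x" m] split [of "x * corner m 0" m] ij [of 0] x by simp
  qed
  show ?thesis
    using b
  proof (induction m arbitrary: b)
    case 0
    then have b: "b \<in> carrier_mat 2 2" by simp
    have off: "f 0 (?E 0 1) = 0" "f 0 (?E 1 0) = 0"
      using diag [of "?E 0 1" 0] diag [of "?E 1 0" 0] zero [of 0]
      by (simp_all add: corner_0 matrix_unit_mult)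
    have "b = (b $$ (0, 0) \<cdot>\<^sub>m ?E 0 0 + b $$ (0, 1) \<cdot>\<^sub>m ?E 0 1)
        + (b $$ (1, 0) \<cdot>\<^sub>m ?E 1 0 + b $$ (1, 1) \<cdot>\<^sub>m ?E 1 1)"
      using b by (intro mat2_eqI) simp_all
    also have "f 0 \<dots> = 0"
      using off base by (simp add: add smult)
    finally show ?case .
  next
    case (Suc m)
    have K: "kron (?E i j) y \<in> M (Suc m)" if "y \<in> M m" for i j y
      using that by simp
    have off: "f (Suc m) (kron (?E 0 1) x) = 0" "f (Suc m) (kron (?E 1 0) x) = 0" if x: "x \<in> M m" for x
    proof -
      have left: "corner (Suc m) 0 * kron (?E i j) x = kron (?E 0 0 * ?E i j) x" for i j
        unfolding corner_def power2_Suc_eq_tsize kron_mult [OF E E one_carrier_mat x] using x by simp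
      have right: "kron (?E i j) x * corner (Suc m) 0 = kron (?E i j * ?E 0 0) x" for i j
        unfolding corner_def power2_Suc_eq_tsize kron_mult [OF E E x one_carrier_mat] using x by simp
      show "f (Suc m) (kron (?E 0 1) x) = 0" "f (Suc m) (kron (?E 1 0) x) = 0"
        using diag [OF K [OF x], of 0 1] diag [OF K [OF x], of 1 0] zero [of "Suc m"] x
        unfolding left right
        by (simp_all add: matrix_unit_mult kron_zero_left [of _ "tsize m"] tsize_Suc)
    qed
    have on: "f (Suc m) (kron (?E 0 0) x) = 0" "f (Suc m) (kron (?E 1 1) x) = 0" if x: "x \<in> M m" for x
    proof -
      \<comment> \<open>\<open>J\<close> moves the block at \<open>(0, 1)\<close> down to \<open>(1, 1)\<close> from the left, and over to \<open>(0, 0)\<close> from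
          the right.\<close>
      have J1: "J_mat 2 * ?E 0 1 = (1/2) \<cdot>\<^sub>m (?E 0 1 + ?E 1 1)"
        and J2: "?E 0 1 * J_mat 2 = (1/2) \<cdot>\<^sub>m (?E 0 0 + ?E 0 1)"
        by (rule mat2_eqI; simp add: index_mult_mat2 index_J_mat del: index_mult_mat(1))+
      have H: "kron ((1/2) \<cdot>\<^sub>m (?E i j + ?E k l)) x
          = (1/2) \<cdot>\<^sub>m (kron (?E i j) x + kron (?E k l) x)" for i j k l
        by (subst kron_smult_left [of _ 2 _ "tsize m"])
          (simp_all add: x kron_add_left [of _ 2 _ _ "tsize m"])
      have "jones_projection 2 (2 * Suc m) * kron (?E 0 1) x
          = (1/2) \<cdot>\<^sub>m (kron (?E 0 1) x + kron (?E 1 1) x)"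
        unfolding jones_projection_even power2_Suc_eq_tsize
          kron_mult [OF J_mat_carrier E one_carrier_mat x] J1 H [symmetric] using x by simp
      moreover have "kron (?E 0 1) x * jones_projection 2 (2 * Suc m)
          = (1/2) \<cdot>\<^sub>m (kron (?E 0 0) x + kron (?E 0 1) x)"
        unfolding jones_projection_even power2_Suc_eq_tsize
          kron_mult [OF E J_mat_carrier x one_carrier_mat] J2 H [symmetric] using x by simp
      ultimately have "f (Suc m) (kron (?E 0 0) x) = f (Suc m) (kron (?E 1 1) x)"
        using even [OF K [OF x], of 0 1] x by (simp add: add smult)
      then show "f (Suc m) (kron (?E 0 0) x) = 0" "f (Suc m) (kron (?E 1 1) x) = 0"
        using split [OF x] Suc.IH [OF x] by simp_all
    qed
    obtain p q r s where pqrs: "p \<in> M m" "q \<in> M m" "r \<in> M m" "s \<in> M m"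
      and b: "b = kron (?E 0 0) p + kron (?E 0 1) q + (kron (?E 1 0) r + kron (?E 1 1) s)"
      using block_decomposition [OF Suc.prems] .
    show ?case
      unfolding b using on off pqrs by (simp add: add)
  qed
qed

section \<open>The GNS representation of the tower\<close>

lemma normalized_trace_commute:
  assumes "A \<in> carrier_mat n n" and "B \<in> carrier_mat n n"
  shows "normalized_trace (A * B) = normalized_trace (B * A)"
proof -
  have "(\<Sum>i<n. (A * B) $$ (i, i)) = (\<Sum>i<n. \<Sum>k<n. A $$ (i, k) * B $$ (k, i))"
    by (intro sum.cong refl) (simp add: index_mult_square [OF assms] del: index_mult_mat(1))
  also have "\<dots> = (\<Sum>k<n. \<Sum>i<n. B $$ (k, i) * A $$ (i, k))"
    by (subst sum.swap) (simp add: mult.commute)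
  also have "\<dots> = (\<Sum>k<n. (B * A) $$ (k, k))"
    by (intro sum.cong refl) (simp add: index_mult_square [OF assms(2,1)] del: index_mult_mat(1))
  finally show ?thesis
    using assms by (simp add: normalized_trace_def)
qed

lemma tower_even: "tower 2 (2 * m) = M m"
  by (simp add: tower_def full_power_def tsize_def)

lemma tower_odd: "tower 2 (Suc (2 * m)) = alg_tensor (diag_alg 2) (M m)"
  by (simp add: tower_def full_power_def tsize_def)

lemma diag_alg_carrier: "d \<in> diag_alg n \<Longrightarrow> d \<in> carrier_mat n n"
  by (simp add: diag_alg_def)

lemma alg_tensor_diag_subset: "x \<in> alg_tensor (diag_alg 2) (M m) \<Longrightarrow> x \<in> M (Suc m)"
  by (induction rule: alg_tensor.induct) (simp_all add: diag_alg_carrier)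

lemma matrix_unit_in_diag_alg: "matrix_unit n i i \<in> diag_alg n"
  by (simp add: diag_alg_def diagonal_mat_def)

lemma one_in_diag_alg: "1\<^sub>m n \<in> diag_alg n"
  by (simp add: diag_alg_def diagonal_mat_def)

text \<open>A representation of the tower identifies the levels on elements of the tower alone. Membership
  makes the odd Jones projection act as it does at the next even level.\<close>

lemma jones_odd_in_tower: "jones_projection 2 (2 * m + 1) \<in> tower 2 (2 * m + 1)"
  unfolding jones_projection_odd
  by (simp add: tower_odd add_in_alg_tensor kron_in_alg_tensor matrix_unit_in_diag_alg)

locale tower_gns =
  fixes \<pi> :: "nat \<Rightarrow> complex mat \<Rightarrow> 'h::complex_hilbert \<Rightarrow>\<^sub>L 'h" and \<Omega> :: 'h
  assumes gns: "gns_representation 2 \<pi> \<Omega>"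
begin

text \<open>The even levels of the tower are the full matrix algebras \<open>M m\<close>. The odd levels lie between
  them and add nothing to the union.\<close>

definition \<rho> :: "nat \<Rightarrow> complex mat \<Rightarrow> 'h \<Rightarrow>\<^sub>L 'h" where
  "\<rho> m = \<pi> (2 * m)"

definition \<A> :: "('h \<Rightarrow>\<^sub>L 'h) set" where
  "\<A> = (\<Union>m. \<rho> m ` M m)"

lemma rho_bounded: "x \<in> M m \<Longrightarrow> \<rho> m x \<in> bounded_ops"
  using gns by (simp add: gns_representation_def \<rho>_def tower_even [symmetric])

lemma rho_one: "\<rho> m (1\<^sub>m (tsize m)) = id_blinfun"
proof -
  have "tower_dim 2 (2 * m) = tsize m" by (simp add: tower_dim_def tsize_def)
  then show ?thesis
    using gns unfolding gns_representation_def \<rho>_def by metis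
qed

lemma rho_add: "x \<in> M m \<Longrightarrow> y \<in> M m \<Longrightarrow> \<rho> m (x + y) = \<rho> m x + \<rho> m y"
  using gns by (simp add: gns_representation_def \<rho>_def tower_even [symmetric])

lemma rho_mult: "x \<in> M m \<Longrightarrow> y \<in> M m \<Longrightarrow> \<rho> m (x * y) = \<rho> m x o\<^sub>L \<rho> m y"
  using gns by (simp add: gns_representation_def \<rho>_def tower_even [symmetric])

lemma rho_smult: "x \<in> M m \<Longrightarrow> \<rho> m (c \<cdot>\<^sub>m x) = scaleC_op c (\<rho> m x)"
  using gns by (simp add: gns_representation_def \<rho>_def tower_even [symmetric])

lemma rho_adjoint: "x \<in> M m \<Longrightarrow> is_adjoint (\<rho> m x) (\<rho> m (mat_adjoint x))"
  using gns by (simp add: gns_representation_def \<rho>_def tower_even [symmetric])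

lemma rho_trace: "x \<in> M m \<Longrightarrow> cinner (\<rho> m x \<Omega>) \<Omega> = normalized_trace x"
  using gns by (simp add: gns_representation_def \<rho>_def tower_even [symmetric])

lemma pi_incl: "x \<in> tower 2 k \<Longrightarrow> \<pi> (Suc k) (tower_incl 2 k x) = \<pi> k x"
  using gns by (simp add: gns_representation_def)

lemma pi_odd: "x \<in> tower 2 (Suc (2 * m)) \<Longrightarrow> \<pi> (Suc (2 * m)) x = \<rho> (Suc m) x"
  using pi_incl [of x "Suc (2 * m)"] by (simp add: \<rho>_def tower_incl_def)

lemma rho_Suc:
  assumes x: "x \<in> M m"
  shows "\<rho> (Suc m) (kron (1\<^sub>m 2) x) = \<rho> m x"
proof -
  have "kron (1\<^sub>m 2) x \<in> tower 2 (Suc (2 * m))"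
    unfolding tower_odd by (intro kron_in_alg_tensor one_in_diag_alg x)
  then have "\<rho> (Suc m) (kron (1\<^sub>m 2) x) = \<pi> (Suc (2 * m)) (kron (1\<^sub>m 2) x)"
    by (rule pi_odd [symmetric])
  also have "\<dots> = \<rho> m x"
    using pi_incl [of x "2 * m"] x by (simp add: tower_even tower_incl_def \<rho>_def)
  finally show ?thesis .
qed

lemma rho_lift: "x \<in> M m \<Longrightarrow> \<rho> (m + k) (lift k x) = \<rho> m x"
  by (induction k) (simp_all add: rho_Suc lift_carrier)

lemma Union_tower: "(\<Union>k. \<pi> k ` tower 2 k) = \<A>"
proof
  show "(\<Union>k. \<pi> k ` tower 2 k) \<subseteq> \<A>"
  proof safe
    fix k x assume x: "x \<in> tower 2 k"
    show "\<pi> k x \<in> \<A>"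
    proof (cases "even k")
      case True
      then obtain m where "k = 2 * m" by (elim evenE)
      then show ?thesis using x by (auto simp: \<A>_def \<rho>_def tower_even)
    next
      case False
      then obtain m where "k = Suc (2 * m)" by (metis oddE Suc_eq_plus1)
      then show ?thesis
        using x pi_odd alg_tensor_diag_subset by (fastforce simp: \<A>_def tower_odd)
    qed
  qed
  show "\<A> \<subseteq> (\<Union>k. \<pi> k ` tower 2 k)"
    by (auto simp: \<A>_def \<rho>_def tower_even [symmetric])
qed

lemma hyperfinite_R_eq: "hyperfinite_R 2 \<pi> = strong_operator_topology closure_of \<A>"
  by (simp add: hyperfinite_R_def Union_tower)

lemma rho_in: "x \<in> M m \<Longrightarrow> \<rho> m x \<in> \<A>"
  by (auto simp: \<A>_def)

lemma dense: "closure ((\<lambda>A. blinfun_apply A \<Omega>) ` \<A>) = UNIV"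
proof -
  have "(\<Union>k. (\<lambda>x. \<pi> k x \<Omega>) ` tower 2 k) = (\<lambda>A. blinfun_apply A \<Omega>) ` \<A>"
    unfolding Union_tower [symmetric] by auto
  then show ?thesis
    using gns by (simp add: gns_representation_def)
qed

lemma common_level:
  assumes "A \<in> \<A>" and "B \<in> \<A>"
  obtains m x y where "x \<in> M m" "y \<in> M m" "A = \<rho> m x" "B = \<rho> m y"
proof -
  obtain k l a b where a: "a \<in> M k" "A = \<rho> k a" and b: "b \<in> M l" "B = \<rho> l b"
    using assms by (auto simp: \<A>_def)
  show thesis
  proof (rule that)
    show "lift l a \<in> M (k + l)" using a lift_carrier by blast
    show "lift k b \<in> M (k + l)" using b(1) lift_carrier [of b l k] by (simp add: add.commute)
    show "A = \<rho> (k + l) (lift l a)" using a by (simp add: rho_lift)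
    show "B = \<rho> (k + l) (lift k b)" using b rho_lift [of b l k] by (simp add: add.commute)
  qed
qed

lemma mult_in: "A \<in> \<A> \<Longrightarrow> B \<in> \<A> \<Longrightarrow> A o\<^sub>L B \<in> \<A>"
  by (erule (1) common_level) (simp add: rho_mult [symmetric] rho_in)

lemma adjoint_in:
  assumes "A \<in> \<A>"
  obtains B where "B \<in> \<A>" and "is_adjoint A B"
proof -
  from assms obtain m x where "x \<in> M m" "A = \<rho> m x" by (auto simp: \<A>_def)
  then show thesis
    using that [OF rho_in [OF mat_adjoint_carrier]] rho_adjoint by blast
qed

lemma trace_commute:
  fixes A B :: "'h \<Rightarrow>\<^sub>L 'h"
  assumes "A \<in> \<A>" and "B \<in> \<A>"
  shows "cinner (A (B \<Omega>)) \<Omega> = cinner (B (A \<Omega>)) \<Omega>"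
proof -
  obtain m x y where xy: "x \<in> M m" "y \<in> M m" and AB: "A = \<rho> m x" "B = \<rho> m y"
    using common_level [OF assms] .
  have "cinner (A (B \<Omega>)) \<Omega> = cinner (\<rho> m (x * y) \<Omega>) \<Omega>"
    using xy by (simp add: AB rho_mult)
  also have "\<dots> = cinner (\<rho> m (y * x) \<Omega>) \<Omega>"
    using xy normalized_trace_commute [OF xy] by (simp add: rho_trace)
  finally show ?thesis
    using xy by (simp add: AB rho_mult)
qed

text \<open>The trace property \<open>\<tau> (B\<^sup>* T A) = \<tau> (A B\<^sup>* T)\<close>, written so that it makes sense for every operator
  \<open>T\<close> and is preserved by strong limits.\<close>

definition tracial :: "('h \<Rightarrow>\<^sub>L 'h) set" where
  "tracial = {T :: 'h \<Rightarrow>\<^sub>L 'h. \<forall>A\<in>\<A>. \<forall>A'\<in>\<A>. \<forall>B\<in>\<A>. is_adjoint A A' \<longrightarrow>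
     cinner (T (A \<Omega>)) (B \<Omega>) = cinner (T \<Omega>) (B (A' \<Omega>))}"

lemma tracialD:
  fixes T A A' B :: "'h \<Rightarrow>\<^sub>L 'h"
  shows "T \<in> tracial \<Longrightarrow> A \<in> \<A> \<Longrightarrow> A' \<in> \<A> \<Longrightarrow> B \<in> \<A> \<Longrightarrow> is_adjoint A A' \<Longrightarrow>
    cinner (T (A \<Omega>)) (B \<Omega>) = cinner (T \<Omega>) (B (A' \<Omega>))"
  by (auto simp: tracial_def)

lemma \<A>_subset_tracial: "\<A> \<subseteq> tracial"
proof -
  have "cinner (T (A \<Omega>)) (B \<Omega>) = cinner (T \<Omega>) (B (A' \<Omega>))"
    if TAB: "T \<in> \<A>" "A \<in> \<A>" "A' \<in> \<A>" "B \<in> \<A>" and A': "is_adjoint A A'" for T A A' B :: "'h \<Rightarrow>\<^sub>L 'h"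
  proof -
    obtain B' where B': "B' \<in> \<A>" "is_adjoint B B'" using adjoint_in [OF TAB(4)] .
    have "cinner (T (A \<Omega>)) (B \<Omega>) = cinner ((B' o\<^sub>L T) (A \<Omega>)) \<Omega>"
      using is_adjoint_sym [OF B'(2)] by (simp add: is_adjoint_def)
    also have "\<dots> = cinner (A ((B' o\<^sub>L T) \<Omega>)) \<Omega>"
      by (rule trace_commute) (use TAB B' mult_in in auto)
    also have "\<dots> = cinner (T \<Omega>) (B (A' \<Omega>))"
      using is_adjoint_sym [OF B'(2)] A' by (simp add: is_adjoint_def)
    finally show ?thesis .
  qed
  then show ?thesis by (auto simp: tracial_def)
qed

lemma closedin_tracial: "closedin strong_operator_topology tracial"
proof -
  let ?I = "{(A, A', B). A \<in> \<A> \<and> A' \<in> \<A> \<and> B \<in> \<A> \<and> is_adjoint A A'}"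
  define S where "S p = {T. cinner (blinfun_apply T (blinfun_apply (fst p) \<Omega>))
      (blinfun_apply (snd (snd p)) \<Omega>)
      = cinner (blinfun_apply T \<Omega>) (blinfun_apply (snd (snd p)) (blinfun_apply (fst (snd p)) \<Omega>))}"
    for p :: "('h \<Rightarrow>\<^sub>L 'h) \<times> ('h \<Rightarrow>\<^sub>L 'h) \<times> ('h \<Rightarrow>\<^sub>L 'h)"
  have "closedin strong_operator_topology (S p)" for p
    unfolding S_def
    by (intro closedin_sot_eq continuous_map_sot_apply continuous_on_cinner continuous_on_id
        continuous_on_const)
  moreover have "tracial = (\<Inter>p\<in>insert (0, 0, 0) ?I. S p)"
    by (auto simp: tracial_def S_def)
  ultimately show ?thesis
    by (simp only:) (rule closedin_INT, auto)
qed

lemma hyperfinite_R_subset: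
  assumes "closedin strong_operator_topology S" and "\<A> \<subseteq> S"
  shows "hyperfinite_R 2 \<pi> \<subseteq> S"
  unfolding hyperfinite_R_eq by (rule closure_of_minimal [OF assms(2,1)])

lemma R_subset_tracial: "hyperfinite_R 2 \<pi> \<subseteq> tracial"
  by (rule hyperfinite_R_subset [OF closedin_tracial \<A>_subset_tracial])

lemma R_subset_bounded: "hyperfinite_R 2 \<pi> \<subseteq> bounded_ops"
  by (rule hyperfinite_R_subset [OF closedin_sot_bounded_ops]) (auto simp: \<A>_def rho_bounded)

lemma \<A>_subset_R: "\<A> \<subseteq> hyperfinite_R 2 \<pi>"
  unfolding hyperfinite_R_eq by (rule closure_of_subset) (simp add: strong_operator_topology_topspace)

lemma tracial_diff: "S \<in> tracial \<Longrightarrow> T \<in> tracial \<Longrightarrow> S - T \<in> tracial"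
  by (auto simp: tracial_def blinfun.diff_left cinner_diff_left)

lemma vector_eqI:
  assumes "\<And>A :: 'h \<Rightarrow>\<^sub>L 'h. A \<in> \<A> \<Longrightarrow> cinner \<xi> (A \<Omega>) = cinner \<eta> (A \<Omega>)"
  shows "\<xi> = \<eta>"
proof (rule cinner_eqI)
  show "cinner \<xi> \<zeta> = cinner \<eta> \<zeta>" for \<zeta>
    by (rule closed_eq_dense [OF dense, of "cinner \<xi>" "cinner \<eta>"])
      (auto intro!: continuous_on_cinner continuous_on_id continuous_on_const assms)
qed

text \<open>The trace property moves \<open>A\<close> in \<open>\<langle>T A \<Omega>, B \<Omega>\<rangle>\<close> to the other side, where it does not meet \<open>T\<close>. So \<open>\<Omega>\<close> is
  separating.\<close>

lemma tracial_zeroI: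
  fixes T :: "'h \<Rightarrow>\<^sub>L 'h"
  assumes T: "T \<in> tracial" and zero: "T \<Omega> = 0"
  shows "T = 0"
proof (rule blinfun_eqI)
  have zero_on: "T (A \<Omega>) = 0" if A: "A \<in> \<A>" for A :: "'h \<Rightarrow>\<^sub>L 'h"
  proof (rule vector_eqI)
    obtain A' where A': "A' \<in> \<A>" "is_adjoint A A'" using adjoint_in [OF A] .
    show "cinner (T (A \<Omega>)) (B \<Omega>) = cinner 0 (B \<Omega>)" if "B \<in> \<A>" for B :: "'h \<Rightarrow>\<^sub>L 'h"
      using tracialD [OF T A A'(1) that A'(2)] zero by simp
  qed
  show "T \<xi> = blinfun_apply 0 \<xi>" for \<xi>
    by (rule closed_eq_dense [OF dense continuous_on_blinfun [of _ T] continuous_on_blinfun [of _ 0]])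
      (auto simp: zero_on)
qed

lemma jones_odd_in:
  "\<pi> (2 * m + 1) (jones_projection 2 (2 * m + 1)) = \<rho> (Suc m) (jones_projection 2 (2 * m + 1))"
  using pi_odd jones_odd_in_tower by simp

text \<open>An operator with the trace property that commutes with all Jones projections gives a functional
  that the Jones projections centralize. So two scalars determine it.\<close>

lemma commutes_with_jones_zero:
  fixes x :: "'h \<Rightarrow>\<^sub>L 'h"
  assumes x: "x \<in> tracial"
    and comm: "\<And>j. 1 \<le> j \<Longrightarrow>
      x o\<^sub>L \<pi> j (jones_projection 2 j) = \<pi> j (jones_projection 2 j) o\<^sub>L x"
    and base: "cinner (\<rho> 0 (matrix_unit 2 0 0) \<Omega>) (x \<Omega>) = 0"
      "cinner (\<rho> 0 (matrix_unit 2 1 1) \<Omega>) (x \<Omega>) = 0"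
  shows "x = 0"
proof (rule tracial_zeroI [OF x])
  define f where "f m b = cinner (\<rho> m b \<Omega>) (x \<Omega>)" for m b
  have central: "f m (e * b) = f m (b * e)"
    if e: "e \<in> M m" "mat_adjoint e = e" and b: "b \<in> M m" and c: "x o\<^sub>L \<rho> m e = \<rho> m e o\<^sub>L x" for m e b
  proof -
    have adj: "is_adjoint (\<rho> m e) (\<rho> m e)" using rho_adjoint [OF e(1)] e(2) by simp
    have "f m (e * b) = cinner (\<rho> m e (\<rho> m b \<Omega>)) (x \<Omega>)"
      using e b by (simp add: f_def rho_mult)
    also have "\<dots> = cinner (\<rho> m b \<Omega>) (\<rho> m e (x \<Omega>))"
      using adj by (simp add: is_adjoint_def)
    also have "\<rho> m e (x \<Omega>) = x (\<rho> m e \<Omega>)"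
      using arg_cong [OF c, of "\<lambda>T. blinfun_apply T \<Omega>"] by simp
    also have "cinner (\<rho> m b \<Omega>) (x (\<rho> m e \<Omega>)) = cnj (cinner (x (\<rho> m e \<Omega>)) (\<rho> m b \<Omega>))"
      by (rule cinner_commute)
    also have "cinner (x (\<rho> m e \<Omega>)) (\<rho> m b \<Omega>) = cinner (x \<Omega>) (\<rho> m b (\<rho> m e \<Omega>))"
      using e b by (intro tracialD [OF x] rho_in adj)
    also have "cnj \<dots> = f m (b * e)"
      using e b by (simp add: f_def rho_mult cinner_commute [of "x \<Omega>"])
    finally show ?thesis .
  qed
  have f: "f m b = 0" if "b \<in> M m" for m b
  proof (rule centralized_functional_zero [of f, OF _ _ _ _ _ _ _ that])
    show "f k (y + z) = f k y + f k z" if "y \<in> M k" "z \<in> M k" for k y z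
      using that by (simp add: f_def rho_add blinfun.add_left cinner_add_left)
    show "f k (c \<cdot>\<^sub>m y) = c * f k y" if "y \<in> M k" for k c y
      using that by (simp add: f_def rho_smult scaleC_op.rep_eq cinner_scaleC_left)
    show "f (Suc k) (kron (1\<^sub>m 2) y) = f k y" if "y \<in> M k" for k y
      using that by (simp add: f_def rho_Suc)
    show "f (Suc k) (jones_projection 2 (2 * k + 1) * y) = f (Suc k) (y * jones_projection 2 (2 * k + 1))"
      if "y \<in> M (Suc k)" for k y
      using that comm [of "2 * k + 1"] unfolding jones_odd_in
      by (intro central jones_projection_odd_carrier mat_adjoint_jones_odd) simp_all
    show "f (Suc k) (jones_projection 2 (2 * Suc k) * y) = f (Suc k) (y * jones_projection 2 (2 * Suc k))"
      if "y \<in> M (Suc k)" for k y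
      using that comm [of "2 * Suc k"] unfolding \<rho>_def [symmetric]
      by (intro central jones_projection_even_carrier mat_adjoint_jones_even) simp_all
    show "f 0 (matrix_unit 2 0 0) = 0" "f 0 (matrix_unit 2 1 1) = 0"
      using base by (simp_all add: f_def)
  qed
  show "x \<Omega> = 0"
  proof (rule vector_eqI)
    fix A :: "'h \<Rightarrow>\<^sub>L 'h" assume "A \<in> \<A>"
    then obtain m b where "b \<in> M m" "A = \<rho> m b" by (auto simp: \<A>_def)
    then show "cinner (x \<Omega>) (A \<Omega>) = cinner 0 (A \<Omega>)"
      using f [of b m] by (subst cinner_commute) (simp add: f_def)
  qed
qed

end

section \<open>Symmetries of the GNS space\<close>

context tower_gns
begin

text \<open>The involutions of the algebras \<open>M m\<close> agree along the inclusions, and so any two vectors of the dense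
  subspace can be compared at a common level; there, symmetry is the assumption. For membership in the
  commutant, an element \<open>c\<close> of level \<open>m\<close> has to be tested at all higher levels, where its image is
  \<open>lift k c\<close>.\<close>

lemma involution_on_GNS_space:
  fixes t :: "nat \<Rightarrow> complex mat \<Rightarrow> complex mat"
  assumes t_in: "\<And>m x. x \<in> M m \<Longrightarrow> t m x \<in> M m"
    and incl: "\<And>m x. x \<in> M m \<Longrightarrow> t (Suc m) (kron (1\<^sub>m 2) x) = kron (1\<^sub>m 2) (t m x)"
    and invol: "\<And>m x. x \<in> M m \<Longrightarrow> \<rho> m (t m (t m x)) = \<rho> m x"
    and sym: "\<And>m x y. x \<in> M m \<Longrightarrow> y \<in> M m \<Longrightarrow>
      cinner (\<rho> m (t m x) \<Omega>) (\<rho> m y \<Omega>) = cinner (\<rho> m x \<Omega>) (\<rho> m (t m y) \<Omega>)"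
  obtains V where "symmetric_map V"
    and "\<And>m x. x \<in> M m \<Longrightarrow> V (\<rho> m x \<Omega>) = \<rho> m (t m x) \<Omega>"
    and "\<And>m c. c \<in> M m \<Longrightarrow>
      (\<And>k y. y \<in> M (m + k) \<Longrightarrow>
        \<rho> (m + k) (t (m + k) (lift k c * y)) = \<rho> (m + k) (lift k c * t (m + k) y)) \<Longrightarrow>
      \<rho> m c \<in> symmetric_map.commutant V"
proof -
  define I where "I = (SIGMA m:UNIV. M m)"
  define a where "a = (\<lambda>(m, x). \<rho> m x \<Omega>)"
  define b where "b = (\<lambda>(m, x). \<rho> m (t m x) \<Omega>)"
  have t_lift: "t (m + k) (lift k x) = lift k (t m x)" if "x \<in> M m" for m k x
    by (induction k) (simp_all add: incl lift_carrier that)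
  have raise: "\<exists>y\<in>M (m + k). a (m, x) = a (m + k, y) \<and> b (m, x) = b (m + k, y)"
    if x: "x \<in> M m" for m x k
    using x t_in [OF x] by (intro bexI [of _ "lift k x"]) (simp_all add: a_def b_def rho_lift t_lift lift_carrier)
  have dense_a: "closure (a ` I) = UNIV"
  proof -
    have "a ` I = (\<lambda>A. blinfun_apply A \<Omega>) ` \<A>"
    proof (intro equalityI subsetI)
      fix \<zeta> assume "\<zeta> \<in> (\<lambda>A. blinfun_apply A \<Omega>) ` \<A>"
      then obtain m x where "x \<in> M m" "\<zeta> = a (m, x)" by (auto simp: \<A>_def a_def)
      then show "\<zeta> \<in> a ` I" by (intro image_eqI [of _ _ "(m, x)"]) (simp_all add: I_def)
    qed (auto simp: a_def I_def rho_in)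
    then show ?thesis using dense by simp
  qed
  obtain V where V: "symmetric_map V" and V_a: "\<And>i. i \<in> I \<Longrightarrow> V (a i) = b i"
  proof (rule symmetric_extension [OF dense_a])
    show "cinner (b i) (a j) = cinner (a i) (b j)" if ij: "i \<in> I" "j \<in> I" for i j
    proof -
      obtain m x n y where i: "i = (m, x)" "x \<in> M m" and j: "j = (n, y)" "y \<in> M n"
        using ij by (auto simp: I_def)
      obtain x' where x': "x' \<in> M (m + n)" "a i = a (m + n, x')" "b i = b (m + n, x')"
        using raise [OF i(2), of n] i(1) by auto
      obtain y' where y': "y' \<in> M (m + n)" "a j = a (m + n, y')" "b j = b (m + n, y')"
        using raise [OF j(2), of m] j(1) by (auto simp: add.commute)
      show ?thesis using sym [OF x'(1) y'(1)] by (simp add: x'(2,3) y'(2,3)) (simp add: a_def b_def)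
    qed
    show "\<exists>j\<in>I. a j = b i \<and> b j = a i" if i: "i \<in> I" for i
    proof -
      obtain m x where "i = (m, x)" "x \<in> M m" using i by (auto simp: I_def)
      then show ?thesis
        by (intro bexI [of _ "(m, t m x)"]) (simp_all add: a_def b_def I_def invol t_in)
    qed
  qed blast
  interpret symmetric_map V by (rule V)
  have V_rho: "V (\<rho> m x \<Omega>) = \<rho> m (t m x) \<Omega>" if "x \<in> M m" for m x
    using V_a [of "(m, x)"] that by (simp add: a_def b_def I_def)
  have "\<rho> m c \<in> commutant"
    if c: "c \<in> M m" and comm: "\<And>k y. y \<in> M (m + k) \<Longrightarrow>
      \<rho> (m + k) (t (m + k) (lift k c * y)) = \<rho> (m + k) (lift k c * t (m + k) y)" for m c
  proof -
    have on: "\<rho> m c (V \<zeta>) = V (\<rho> m c \<zeta>)" if "\<zeta> \<in> a ` I" for \<zeta>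
    proof -
      obtain n y where y: "y \<in> M n" "\<zeta> = a (n, y)" using \<open>\<zeta> \<in> a ` I\<close> by (auto simp: I_def)
      obtain y' where y': "y' \<in> M (m + n)" "\<zeta> = \<rho> (m + n) y' \<Omega>"
        using raise [OF y(1), of m] y(2) by (auto simp: a_def add.commute)
      note l = lift_carrier [OF c, of n]
      have "\<rho> m c (V \<zeta>) = \<rho> (m + n) (lift n c * t (m + n) y') \<Omega>"
        using y' l by (simp add: V_rho rho_mult t_in rho_lift [OF c])
      also have "\<dots> = V (\<rho> (m + n) (lift n c * y') \<Omega>)"
        using y' l by (simp add: V_rho comm)
      also have "\<dots> = V (\<rho> m c \<zeta>)"
        using y' l by (simp add: rho_mult rho_lift [OF c])
      finally show ?thesis .
    qed
    have "\<rho> m c (V \<xi>) = V (\<rho> m c \<xi>)" for \<xi>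
    proof (rule closed_eq_dense [OF dense_a, of "\<lambda>\<xi>. \<rho> m c (V \<xi>)" "\<lambda>\<xi>. V (\<rho> m c \<xi>)"])
      show "continuous_on UNIV (\<lambda>\<xi>. \<rho> m c (V \<xi>))"
        using continuous_on_compose2 [OF continuous_on_blinfun [of UNIV "\<rho> m c"] continuous] by simp
      show "continuous_on UNIV (\<lambda>\<xi>. V (\<rho> m c \<xi>))"
        using continuous_on_compose2 [OF continuous continuous_on_blinfun [of UNIV "\<rho> m c"]] by simp
    qed (rule on)
    then show ?thesis
      unfolding commutant_def using rho_bounded [OF c] by simp
  qed
  then show thesis
    using V V_rho by (intro that) auto
qed

lemma rho_unitary:
  assumes "u \<in> M m" and "mat_adjoint u = u" and "u * u = 1\<^sub>m (tsize m)"
  shows "is_adjoint (\<rho> m u) (\<rho> m u)" and "\<rho> m u (\<rho> m u \<xi>) = \<xi>"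
proof -
  show "is_adjoint (\<rho> m u) (\<rho> m u)" using rho_adjoint [OF assms(1)] assms(2) by simp
  have "\<rho> m u o\<^sub>L \<rho> m u = id_blinfun"
    using assms by (simp add: rho_mult [symmetric] rho_one)
  then show "\<rho> m u (\<rho> m u \<xi>) = \<xi>" by (metis blinfun_apply_blinfun_compose blinfun_apply_id_blinfun id_apply)
qed

text \<open>Right multiplication by a self-adjoint element is symmetric: this is the trace property again.\<close>

lemma cinner_right_shift:
  assumes u: "u \<in> M m" "mat_adjoint u = u" and x: "x \<in> M m" and y: "y \<in> M m"
  shows "cinner (\<rho> m x (\<rho> m u \<Omega>)) (\<rho> m y \<Omega>) = cinner (\<rho> m x \<Omega>) (\<rho> m y (\<rho> m u \<Omega>))"
  using \<A>_subset_tracial rho_adjoint [OF u(1)] u x y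
  by (intro tracialD) (auto intro: rho_in)

lemmas rho_flip_string = rho_unitary [OF flip_string_carrier mat_adjoint_flip_string flip_string_flip_string]

lemma lift_flip:
  "lift m (flip \<alpha>) \<in> M m" "mat_adjoint (lift m (flip \<alpha>)) = lift m (flip \<alpha>)"
  "lift m (flip \<alpha>) * lift m (flip \<alpha>) = 1\<^sub>m (tsize m)"
  by (simp_all add: mat_adjoint_lift mat_adjoint_flip lift_mult [of _ 0, symmetric] flip_flip lift_one)

lemmas rho_lift_flip = rho_unitary [OF lift_flip]

text \<open>The operator \<open>V\<^sub>\<alpha>\<close>. Elements that commute with the flips act by operators in its commutant.\<close>

lemma conjugation_symmetry:
  obtains V where "symmetric_map V"
    and "\<And>m x. x \<in> M m \<Longrightarrow> V (\<rho> m x \<Omega>) = \<rho> m (flip_string \<alpha> m * x * flip_string \<alpha> m) \<Omega>"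
    and "\<And>m c. c \<in> M m \<Longrightarrow> flip_string \<alpha> m * c = c * flip_string \<alpha> m \<Longrightarrow>
      \<rho> m c \<in> symmetric_map.commutant V"
proof (rule involution_on_GNS_space [of "\<lambda>m x. flip_string \<alpha> m * x * flip_string \<alpha> m"])
  show "flip_string \<alpha> (Suc m) * kron (1\<^sub>m 2) x * flip_string \<alpha> (Suc m)
      = kron (1\<^sub>m 2) (flip_string \<alpha> m * x * flip_string \<alpha> m)" if "x \<in> M m" for m x
    using that by (simp add: kron_mult [of _ 2 _ _ "tsize m"] flip_flip right_mult_one_mat [of _ 2 2])
  show "\<rho> m (flip_string \<alpha> m * (flip_string \<alpha> m * x * flip_string \<alpha> m) * flip_string \<alpha> m) = \<rho> m x"
    if "x \<in> M m" for m x
    using that by (intro blinfun_eqI) (simp add: rho_mult rho_flip_string)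
  show "cinner (\<rho> m (flip_string \<alpha> m * x * flip_string \<alpha> m) \<Omega>) (\<rho> m y \<Omega>)
      = cinner (\<rho> m x \<Omega>) (\<rho> m (flip_string \<alpha> m * y * flip_string \<alpha> m) \<Omega>)"
    if xy: "x \<in> M m" "y \<in> M m" for m x y
  proof -
    let ?u = "flip_string \<alpha> m"
    have "cinner (\<rho> m x (\<rho> m ?u \<Omega>)) (\<rho> m (?u * y) \<Omega>) = cinner (\<rho> m x \<Omega>) (\<rho> m (?u * y) (\<rho> m ?u \<Omega>))"
      by (rule cinner_right_shift [OF flip_string_carrier mat_adjoint_flip_string]) (use xy in simp_all)
    then show ?thesis
      using xy rho_flip_string(1) [of m \<alpha>] by (simp add: rho_mult is_adjoint_def)
  qed
next
  fix V
  assume V: "symmetric_map V"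
    and V_rho: "\<And>m x. x \<in> M m \<Longrightarrow> V (\<rho> m x \<Omega>) = \<rho> m (flip_string \<alpha> m * x * flip_string \<alpha> m) \<Omega>"
    and comm: "\<And>m c. c \<in> M m \<Longrightarrow>
      (\<And>k y. y \<in> M (m + k) \<Longrightarrow>
        \<rho> (m + k) (flip_string \<alpha> (m + k) * (lift k c * y) * flip_string \<alpha> (m + k))
        = \<rho> (m + k) (lift k c * (flip_string \<alpha> (m + k) * y * flip_string \<alpha> (m + k)))) \<Longrightarrow>
      \<rho> m c \<in> symmetric_map.commutant V"
  show thesis
  proof (rule that [OF V V_rho])
    fix m c assume c: "c \<in> M m" and fc: "flip_string \<alpha> m * c = c * flip_string \<alpha> m"
    show "\<rho> m c \<in> symmetric_map.commutant V"
    proof (rule comm [OF c], rule blinfun_eqI)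
      fix k y \<xi> assume y: "y \<in> M (m + k)"
      note l = lift_carrier [OF c, of k]
      have "\<rho> (m + k) (flip_string \<alpha> (m + k)) o\<^sub>L \<rho> (m + k) (lift k c)
          = \<rho> (m + k) (lift k c) o\<^sub>L \<rho> (m + k) (flip_string \<alpha> (m + k))"
        using l flip_string_lift_commute [OF c fc, of k] by (simp add: rho_mult [symmetric])
      then have "\<rho> (m + k) (flip_string \<alpha> (m + k)) (\<rho> (m + k) (lift k c) \<zeta>)
          = \<rho> (m + k) (lift k c) (\<rho> (m + k) (flip_string \<alpha> (m + k)) \<zeta>)" for \<zeta>
        by (metis blinfun_apply_blinfun_compose)
      then show "\<rho> (m + k) (flip_string \<alpha> (m + k) * (lift k c * y) * flip_string \<alpha> (m + k)) \<xi>
          = \<rho> (m + k) (lift k c * (flip_string \<alpha> (m + k) * y * flip_string \<alpha> (m + k))) \<xi>"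
        using l y by (simp add: rho_mult)
    qed
  qed
qed simp_all

text \<open>Right multiplication commutes with all left multiplications. It is what removes the right half of
  a conjugation.\<close>

lemma right_multiplication_symmetry:
  obtains V where "symmetric_map V"
    and "\<And>m x. x \<in> M m \<Longrightarrow> V (\<rho> m x \<Omega>) = \<rho> m (x * lift m (flip \<alpha>)) \<Omega>"
    and "\<And>m c. c \<in> M m \<Longrightarrow> \<rho> m c \<in> symmetric_map.commutant V"
proof (rule involution_on_GNS_space [of "\<lambda>m x. x * lift m (flip \<alpha>)"])
  show "kron (1\<^sub>m 2) x * lift (Suc m) (flip \<alpha>) = kron (1\<^sub>m 2) (x * lift m (flip \<alpha>))"
    if "x \<in> M m" for m x
    using that by (simp add: kron_mult [of _ 2 _ _ "tsize m"])
  show "\<rho> m (x * lift m (flip \<alpha>) * lift m (flip \<alpha>)) = \<rho> m x" if "x \<in> M m" for m x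
    using that by (intro blinfun_eqI) (simp add: rho_mult rho_lift_flip)
  show "cinner (\<rho> m (x * lift m (flip \<alpha>)) \<Omega>) (\<rho> m y \<Omega>)
      = cinner (\<rho> m x \<Omega>) (\<rho> m (y * lift m (flip \<alpha>)) \<Omega>)"
    if "x \<in> M m" "y \<in> M m" for m x y
    using that cinner_right_shift [OF lift_flip(1,2)] by (simp add: rho_mult)
next
  fix V
  assume V: "symmetric_map V"
    and V_rho: "\<And>m x. x \<in> M m \<Longrightarrow> V (\<rho> m x \<Omega>) = \<rho> m (x * lift m (flip \<alpha>)) \<Omega>"
    and comm: "\<And>m c. c \<in> M m \<Longrightarrow>
      (\<And>k y. y \<in> M (m + k) \<Longrightarrow>
        \<rho> (m + k) (lift k c * y * lift (m + k) (flip \<alpha>))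
        = \<rho> (m + k) (lift k c * (y * lift (m + k) (flip \<alpha>)))) \<Longrightarrow>
      \<rho> m c \<in> symmetric_map.commutant V"
  show thesis
  proof (rule that [OF V V_rho])
    fix m c assume c: "c \<in> M m"
    show "\<rho> m c \<in> symmetric_map.commutant V"
    proof (rule comm [OF c], rule blinfun_eqI)
      fix k y \<xi> assume y: "y \<in> M (m + k)"
      show "\<rho> (m + k) (lift k c * y * lift (m + k) (flip \<alpha>)) \<xi>
          = \<rho> (m + k) (lift k c * (y * lift (m + k) (flip \<alpha>))) \<xi>"
        using y lift_carrier [OF c, of k] by (simp add: rho_mult)
    qed
  qed
qed simp_all

section \<open>The relative commutant\<close>

lemma spin_generator:
  assumes "g \<in> {\<pi> 0 (hadamard2 \<alpha> * d * mat_adjoint (hadamard2 \<alpha>)) |d. d \<in> diag_alg 2} \<union>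
      {\<pi> j (jones_projection 2 j) |j. 1 \<le> j}"
  obtains m c where "c \<in> M m" and "flip_string \<alpha> m * c = c * flip_string \<alpha> m" and "g = \<rho> m c"
  using assms
proof (elim UnE CollectE exE conjE)
  fix d assume d: "g = \<pi> 0 (hadamard2 \<alpha> * d * mat_adjoint (hadamard2 \<alpha>))" "d \<in> diag_alg 2"
  show thesis
    by (rule that [of "hadamard2 \<alpha> * d * mat_adjoint (hadamard2 \<alpha>)" 0])
      (use d diag_alg_carrier flip_commutes_conjugated_diagonal in \<open>simp_all add: \<rho>_def\<close>)
next
  fix j assume g: "g = \<pi> j (jones_projection 2 j)" and j: "1 \<le> j"
  show thesis
  proof (cases "even j")
    case True
    then obtain m where m: "j = 2 * Suc m" using j by (metis evenE mult_0_right not0_implies_Suc not_one_le_zero)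
    then show thesis
      using that [OF jones_projection_even_carrier [of "Suc m"] flip_string_jones_even]
      by (simp add: g \<rho>_def)
  next
    case False
    then obtain m where m: "j = 2 * m + 1" by (elim oddE)
    then show thesis
      using that [OF jones_projection_odd_carrier flip_string_jones_odd] jones_odd_in
      by (simp add: g)
  qed
qed

lemma spin_subfactor_subset_commutant:
  assumes "symmetric_map V"
    and "\<And>m c. c \<in> M m \<Longrightarrow> flip_string \<alpha> m * c = c * flip_string \<alpha> m \<Longrightarrow>
      \<rho> m c \<in> symmetric_map.commutant V"
  shows "spin_subfactor 2 \<pi> (hadamard2 \<alpha>) \<subseteq> symmetric_map.commutant V"
  unfolding spin_subfactor_def
proof (intro von_neumann_generated_subset subsetI)
  show "von_neumann_algebra (symmetric_map.commutant V)"
    by (rule symmetric_map.von_neumann_algebra_commutant [OF assms(1)])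
  fix g assume "g \<in> {\<pi> 0 (hadamard2 \<alpha> * d * mat_adjoint (hadamard2 \<alpha>)) |d. d \<in> diag_alg 2} \<union>
      {\<pi> j (jones_projection 2 j) |j. 1 \<le> j}"
  then obtain m c where c: "c \<in> M m" "flip_string \<alpha> m * c = c * flip_string \<alpha> m" "g = \<rho> m c"
    by (rule spin_generator)
  show "g \<in> symmetric_map.commutant V"
    unfolding c(3) by (rule assms(2) [OF c(1,2)])
qed

text \<open>Let \<open>w = flip \<alpha> * flip \<beta>\<close>, let \<open>V\<close>, \<open>W\<close> be the conjugation symmetries for \<open>\<alpha>\<close>, \<open>\<beta>\<close>, and let \<open>S\<close>, \<open>T\<close>
  be the right multiplications by \<open>flip \<alpha>\<close>, \<open>flip \<beta>\<close>. Then \<open>T S\<close> maps \<open>x \<Omega>\<close> to \<open>x w \<Omega>\<close>, and \<open>V W\<close> maps this to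
  \<open>w x w w\<^sup>* \<Omega> = w x \<Omega>\<close>. So left multiplication by \<open>w\<close> is a composite of maps that commute with \<open>y\<close>.\<close>

lemma intersection_commutes_with_flip_mult_flip:
  fixes y :: "'h \<Rightarrow>\<^sub>L 'h"
  assumes "y \<in> spin_subfactor 2 \<pi> (hadamard2 \<alpha>)" and "y \<in> spin_subfactor 2 \<pi> (hadamard2 \<beta>)"
  shows "y (\<rho> 0 (flip \<alpha> * flip \<beta>) \<xi>) = \<rho> 0 (flip \<alpha> * flip \<beta>) (y \<xi>)"
proof -
  obtain V where V: "symmetric_map V"
    and V_rho: "\<And>m x. x \<in> M m \<Longrightarrow> V (\<rho> m x \<Omega>) = \<rho> m (flip_string \<alpha> m * x * flip_string \<alpha> m) \<Omega>"
    and V_comm: "\<And>m c. c \<in> M m \<Longrightarrow> flip_string \<alpha> m * c = c * flip_string \<alpha> m \<Longrightarrow>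
      \<rho> m c \<in> symmetric_map.commutant V"
    using conjugation_symmetry [of \<alpha>] by blast
  obtain W where W: "symmetric_map W"
    and W_rho: "\<And>m x. x \<in> M m \<Longrightarrow> W (\<rho> m x \<Omega>) = \<rho> m (flip_string \<beta> m * x * flip_string \<beta> m) \<Omega>"
    and W_comm: "\<And>m c. c \<in> M m \<Longrightarrow> flip_string \<beta> m * c = c * flip_string \<beta> m \<Longrightarrow>
      \<rho> m c \<in> symmetric_map.commutant W"
    using conjugation_symmetry [of \<beta>] by blast
  obtain S where S: "symmetric_map S"
    and S_rho: "\<And>m x. x \<in> M m \<Longrightarrow> S (\<rho> m x \<Omega>) = \<rho> m (x * lift m (flip \<alpha>)) \<Omega>"
    and S_comm: "\<And>m c. c \<in> M m \<Longrightarrow> \<rho> m c \<in> symmetric_map.commutant S"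
    using right_multiplication_symmetry [of \<alpha>] by blast
  obtain T where T: "symmetric_map T"
    and T_rho: "\<And>m x. x \<in> M m \<Longrightarrow> T (\<rho> m x \<Omega>) = \<rho> m (x * lift m (flip \<beta>)) \<Omega>"
    and T_comm: "\<And>m c. c \<in> M m \<Longrightarrow> \<rho> m c \<in> symmetric_map.commutant T"
    using right_multiplication_symmetry [of \<beta>] by blast
  have "y \<in> symmetric_map.commutant V" "y \<in> symmetric_map.commutant W"
    "y \<in> symmetric_map.commutant S" "y \<in> symmetric_map.commutant T"
    using assms spin_subfactor_subset_commutant [OF V V_comm] spin_subfactor_subset_commutant [OF W W_comm]
      spin_subfactor_subset_commutant [OF S S_comm, of \<alpha>] spin_subfactor_subset_commutant [OF T T_comm, of \<alpha>]
    by auto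
  then have comm: "y (V \<zeta>) = V (y \<zeta>)" "y (W \<zeta>) = W (y \<zeta>)" "y (S \<zeta>) = S (y \<zeta>)" "y (T \<zeta>) = T (y \<zeta>)" for \<zeta>
    by (simp_all add: symmetric_map.commutant_def V W S T)
  have on: "V (W (T (S \<zeta>))) = \<rho> 0 (flip \<alpha> * flip \<beta>) \<zeta>" if \<zeta>_in: "\<zeta> \<in> (\<lambda>A. blinfun_apply A \<Omega>) ` \<A>" for \<zeta>
  proof -
    obtain m x where x: "x \<in> M m" and \<zeta>: "\<zeta> = \<rho> m x \<Omega>" using \<zeta>_in by (auto simp: \<A>_def)
    let ?u = "\<lambda>\<gamma>. blinfun_apply (\<rho> m (flip_string \<gamma> m))" and ?l = "\<lambda>\<gamma>. blinfun_apply (\<rho> m (lift m (flip \<gamma>)))"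
    have ul: "?u \<gamma> (?u \<delta> \<eta>) = ?l \<gamma> (?l \<delta> \<eta>)" for \<gamma> \<delta> \<eta>
    proof -
      have "\<rho> m (flip_string \<gamma> m) o\<^sub>L \<rho> m (flip_string \<delta> m) = \<rho> m (lift m (flip \<gamma>)) o\<^sub>L \<rho> m (lift m (flip \<delta>))"
        by (simp add: rho_mult [symmetric] flip_string_mult lift_mult [of _ 0])
      then show ?thesis by (metis blinfun_apply_blinfun_compose)
    qed
    have "V (W (T (S \<zeta>))) = ?u \<alpha> (?u \<beta> (\<rho> m x (?l \<alpha> (?l \<beta> (?u \<beta> (?u \<alpha> \<Omega>))))))"
      using x by (simp add: \<zeta> S_rho T_rho V_rho W_rho) (simp add: rho_mult)
    also have "\<dots> = ?l \<alpha> (?l \<beta> (\<rho> m x \<Omega>))"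
      by (simp only: ul rho_lift_flip(2))
    also have "\<dots> = \<rho> m (lift m (flip \<alpha> * flip \<beta>)) \<zeta>"
      by (simp add: \<zeta> lift_mult [of _ 0] rho_mult)
    also have "\<rho> m (lift m (flip \<alpha> * flip \<beta>)) = \<rho> 0 (flip \<alpha> * flip \<beta>)"
      using rho_lift [of "flip \<alpha> * flip \<beta>" 0 m] by simp
    finally show ?thesis .
  qed
  have VWTS: "V (W (T (S \<zeta>))) = \<rho> 0 (flip \<alpha> * flip \<beta>) \<zeta>" for \<zeta>
  proof (rule closed_eq_dense [OF dense, of "\<lambda>\<zeta>. V (W (T (S \<zeta>)))" "blinfun_apply (\<rho> 0 (flip \<alpha> * flip \<beta>))"])
    note cont = V [THEN symmetric_map.continuous] W [THEN symmetric_map.continuous]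
      S [THEN symmetric_map.continuous] T [THEN symmetric_map.continuous]
    show "continuous_on UNIV (\<lambda>\<zeta>. V (W (T (S \<zeta>))))"
      by (rule continuous_on_compose2 [OF cont(1) continuous_on_compose2 [OF cont(2)
            continuous_on_compose2 [OF cont(4) cont(3)]]]) auto
  qed (simp_all add: on continuous_on_blinfun)
  show ?thesis
    by (simp only: VWTS [symmetric] comm)
qed

definition diag_op :: "complex \<Rightarrow> complex \<Rightarrow> 'h \<Rightarrow>\<^sub>L 'h" where
  "diag_op a b = \<rho> 0 (a \<cdot>\<^sub>m matrix_unit 2 0 0 + b \<cdot>\<^sub>m matrix_unit 2 1 1)"

lemma diag_op_in: "diag_op a b \<in> \<A>"
  unfolding diag_op_def by (rule rho_in) simp

lemma diag_op_add: "diag_op a b + diag_op c d = diag_op (a + c) (b + d)"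
  unfolding diag_op_def
  by (subst rho_add [symmetric]; (simp; fail)?)
    (intro arg_cong [of _ _ "\<rho> 0"] mat2_eqI; simp)

lemma diag_op_mult: "diag_op a b o\<^sub>L diag_op c d = diag_op (a * c) (b * d)"
  unfolding diag_op_def
  by (subst rho_mult [symmetric]; (simp; fail)?)
    (intro arg_cong [of _ _ "\<rho> 0"] mat2_eqI; simp add: index_mult_mat2 del: index_mult_mat(1))

lemma diag_op_scale: "scaleC_op k (diag_op a b) = diag_op (k * a) (k * b)"
  unfolding diag_op_def
  by (subst rho_smult [symmetric]; (simp; fail)?)
    (intro arg_cong [of _ _ "\<rho> 0"] mat2_eqI; simp)

lemma diag_op_one: "diag_op 1 1 = id_blinfun"
proof -
  have "1 \<cdot>\<^sub>m matrix_unit 2 0 0 + 1 \<cdot>\<^sub>m matrix_unit 2 1 1 = (1\<^sub>m 2 :: complex mat)"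
    by (rule mat2_eqI) simp_all
  then show ?thesis unfolding diag_op_def using rho_one [of 0] by simp
qed

lemma diag_op_adjoint: "is_adjoint (diag_op a b) (diag_op (cnj a) (cnj b))"
proof -
  have "mat_adjoint (a \<cdot>\<^sub>m matrix_unit 2 0 0 + b \<cdot>\<^sub>m matrix_unit 2 1 1)
      = cnj a \<cdot>\<^sub>m matrix_unit 2 0 0 + cnj b \<cdot>\<^sub>m matrix_unit 2 1 1"
    by (rule mat2_eqI) (simp_all add: index_mat_adjoint [of _ 2])
  then show ?thesis
    unfolding diag_op_def using rho_adjoint [of "a \<cdot>\<^sub>m matrix_unit 2 0 0 + b \<cdot>\<^sub>m matrix_unit 2 1 1" 0]
    by simp
qed

lemma diag_op_cinner: "cinner (diag_op a b \<Omega>) (diag_op c d \<Omega>) = (a * cnj c + b * cnj d) / 2"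
proof -
  have trace: "cinner (diag_op p q \<Omega>) \<Omega> = (p + q) / 2" for p q
    unfolding diag_op_def by (subst rho_trace) (simp_all add: normalized_trace_def numeral_2_eq_2)
  have "cinner (diag_op a b \<Omega>) (diag_op c d \<Omega>) = cinner ((diag_op (cnj c) (cnj d) o\<^sub>L diag_op a b) \<Omega>) \<Omega>"
    using is_adjoint_sym [OF diag_op_adjoint [of c d]] by (simp add: is_adjoint_def)
  then show ?thesis by (simp add: diag_op_mult trace mult.commute)
qed

lemma diag_op_inject: "diag_op a b = diag_op c d \<Longrightarrow> a = c \<and> b = d"
  using diag_op_cinner [of a b 1 0] diag_op_cinner [of a b 0 1]
    diag_op_cinner [of c d 1 0] diag_op_cinner [of c d 0 1] by simp

text \<open>The inequality \<open>exp (\<i> (\<beta> - \<alpha>)) \<noteq> exp (- \<i> (\<beta> - \<alpha>))\<close> makes \<open>flip \<alpha> * flip \<beta>\<close> a diagonal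
  matrix with distinct entries, which generates the diagonal algebra.\<close>

lemma intersection_commutes_with_diag_op:
  fixes y :: "'h \<Rightarrow>\<^sub>L 'h"
  assumes y: "y \<in> spin_subfactor 2 \<pi> (hadamard2 \<alpha>)" "y \<in> spin_subfactor 2 \<pi> (hadamard2 \<beta>)"
    and sin: "sin (\<beta> - \<alpha>) \<noteq> 0"
  shows "diag_op a b o\<^sub>L y = y o\<^sub>L diag_op a b"
proof -
  define z where "z = exp (\<i> * (\<beta> - \<alpha>))"
  define w where "w = exp (- (\<i> * (\<beta> - \<alpha>)))"
  have "z - w = 2 * \<i> * sin (\<beta> - \<alpha>)"
    by (simp add: z_def w_def exp_Euler exp_minus_Euler sin_of_real cos_of_real del: of_real_diff)
  then have zw: "z - w \<noteq> 0" using sin by simp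
  obtain V where V: "symmetric_map V"
    and "\<And>m x. x \<in> M m \<Longrightarrow> V (\<rho> m x \<Omega>) = \<rho> m (flip_string \<alpha> m * x * flip_string \<alpha> m) \<Omega>"
    and V_comm: "\<And>m c. c \<in> M m \<Longrightarrow> flip_string \<alpha> m * c = c * flip_string \<alpha> m \<Longrightarrow>
      \<rho> m c \<in> symmetric_map.commutant V"
    by (rule conjugation_symmetry [of \<alpha>]) blast
  have yb: "y \<in> bounded_ops"
    using spin_subfactor_subset_commutant [OF V V_comm] y(1)
    by (auto simp: symmetric_map.commutant_def [OF V])
  have zw_comm: "y (diag_op z w \<xi>) = diag_op z w (y \<xi>)" for \<xi>
    using intersection_commutes_with_flip_mult_flip [OF y]
    by (simp add: flip_mult_flip diag_op_def z_def w_def)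
  define k l where "k = (a - b) / (z - w)" and "l = b - k * w"
  have "k * (z - w) = a - b" using zw by (simp add: k_def)
  then have "k * z + l = a" by (simp add: l_def algebra_simps)
  moreover have "k * w + l = b" by (simp add: l_def)
  ultimately have ab: "diag_op a b = scaleC_op k (diag_op z w) + scaleC_op l id_blinfun"
    by (simp add: diag_op_one [symmetric] diag_op_scale diag_op_add)
  show ?thesis
    by (rule blinfun_eqI)
      (simp add: ab blinfun.add_left blinfun.add_right scaleC_op.rep_eq bounded_ops_scaleC [OF yb] zw_comm)
qed

lemma jones_in_spin_subfactor:
  "1 \<le> j \<Longrightarrow> \<pi> j (jones_projection 2 j) \<in> spin_subfactor 2 \<pi> u"
  unfolding spin_subfactor_def by (rule subsetD [OF subset_von_neumann_generated]) auto

text \<open>The Fourier coefficients of \<open>x\<close> at the two minimal projections of the diagonal algebra are half of the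
  coordinates \<open>a\<close>, \<open>b\<close>, since these projections have trace \<open>1/2\<close>.\<close>

lemma relative_commutant_eq:
  assumes sin: "sin (\<beta> - \<alpha>) \<noteq> 0"
  shows "relative_commutant
      (spin_subfactor 2 \<pi> (hadamard2 \<alpha>) \<inter> spin_subfactor 2 \<pi> (hadamard2 \<beta>)) (hyperfinite_R 2 \<pi>)
    = range (\<lambda>(a, b). diag_op a b)" (is "relative_commutant ?N _ = _")
proof
  show "range (\<lambda>(a, b). diag_op a b) \<subseteq> relative_commutant ?N (hyperfinite_R 2 \<pi>)"
    using diag_op_in \<A>_subset_R intersection_commutes_with_diag_op [OF _ _ sin]
    by (auto simp: relative_commutant_def)
  show "relative_commutant ?N (hyperfinite_R 2 \<pi>) \<subseteq> range (\<lambda>(a, b). diag_op a b)"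
  proof
    fix x assume x: "x \<in> relative_commutant ?N (hyperfinite_R 2 \<pi>)"
    define a where "a = 2 * cinner (x \<Omega>) (diag_op 1 0 \<Omega>)"
    define b where "b = 2 * cinner (x \<Omega>) (diag_op 0 1 \<Omega>)"
    have unit: "\<rho> 0 (matrix_unit 2 0 0) = diag_op 1 0" "\<rho> 0 (matrix_unit 2 1 1) = diag_op 0 1"
      unfolding diag_op_def by (intro arg_cong [of _ _ "\<rho> 0"] mat2_eqI; simp)+
    have "x - diag_op a b = 0"
    proof (rule commutes_with_jones_zero)
      show "x - diag_op a b \<in> tracial"
        using x R_subset_tracial \<A>_subset_tracial diag_op_in
        by (intro tracial_diff) (auto simp: relative_commutant_def)
      fix j :: nat assume "1 \<le> j"
      then have e: "\<pi> j (jones_projection 2 j) \<in> ?N" by (simp add: jones_in_spin_subfactor)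
      then have "x o\<^sub>L \<pi> j (jones_projection 2 j) = \<pi> j (jones_projection 2 j) o\<^sub>L x"
        using x by (simp add: relative_commutant_def)
      moreover have "diag_op a b o\<^sub>L \<pi> j (jones_projection 2 j) = \<pi> j (jones_projection 2 j) o\<^sub>L diag_op a b"
        using e intersection_commutes_with_diag_op [OF _ _ sin] by blast
      ultimately show "(x - diag_op a b) o\<^sub>L \<pi> j (jones_projection 2 j)
          = \<pi> j (jones_projection 2 j) o\<^sub>L (x - diag_op a b)"
        by (simp add: bounded_bilinear.diff_left [OF bounded_bilinear_blinfun_compose]
            bounded_bilinear.diff_right [OF bounded_bilinear_blinfun_compose])
    next
      have "cinner ((x - diag_op a b) \<Omega>) (diag_op 1 0 \<Omega>) = 0" "cinner ((x - diag_op a b) \<Omega>) (diag_op 0 1 \<Omega>) = 0"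
        by (simp_all add: blinfun.diff_left cinner_diff_left diag_op_cinner a_def b_def)
      then show "cinner (\<rho> 0 (matrix_unit 2 0 0) \<Omega>) ((x - diag_op a b) \<Omega>) = 0"
        "cinner (\<rho> 0 (matrix_unit 2 1 1) \<Omega>) ((x - diag_op a b) \<Omega>) = 0"
        unfolding unit by (metis cinner_commute complex_cnj_zero)+
    qed
    then show "x \<in> range (\<lambda>(a, b). diag_op a b)"
      by (intro range_eqI [of _ _ "(a, b)"]) simp
  qed
qed

end

theorem theorem1p6:
  fixes \<alpha> \<beta> :: real
    and \<pi> :: "nat \<Rightarrow> complex mat \<Rightarrow> 'h::complex_hilbert \<Rightarrow>\<^sub>L 'h"
    and \<Omega> :: 'h
  assumes "gns_representation 2 \<pi> \<Omega>"
    and "\<alpha> \<in> {0..<2 * pi}" and "\<beta> \<in> {0..<2 * pi}"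
    and "\<beta> \<notin> {\<alpha>, \<alpha> + pi, \<alpha> - pi}"
  shows "star_isomorphic_C_plus_C
    (relative_commutant
      (spin_subfactor 2 \<pi> (hadamard2 \<alpha>) \<inter> spin_subfactor 2 \<pi> (hadamard2 \<beta>))
      (hyperfinite_R 2 \<pi>))"
proof -
  interpret tower_gns \<pi> \<Omega> by standard (rule assms(1))
  have sin: "sin (\<beta> - \<alpha>) \<noteq> 0"
  proof
    assume "sin (\<beta> - \<alpha>) = 0"
    then obtain i :: int where i: "\<beta> - \<alpha> = of_int i * pi" by (auto simp: sin_zero_iff_int2)
    have "- (2 * pi) < of_int i * pi" "of_int i * pi < 2 * pi"
      using assms(2,3) unfolding i [symmetric] by auto
    then have "(-2) * pi < of_int i * pi" "of_int i * pi < 2 * pi" by simp_all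
    then have "-2 < real_of_int i" "real_of_int i < 2"
      by (simp_all only: mult_less_cancel_right_pos [OF pi_gt_zero])
    then have "i = -1 \<or> i = 0 \<or> i = 1" by linarith
    then show False using assms(4) i by auto
  qed
  have "diag_op a b \<in> bounded_ops" for a b
    using diag_op_in \<A>_subset_R R_subset_bounded by blast
  then show ?thesis
    unfolding relative_commutant_eq [OF sin]
    by (rule star_isomorphic_C_plus_C_range [of diag_op, OF _ diag_op_one diag_op_add diag_op_mult diag_op_scale
        diag_op_adjoint diag_op_inject])
qed

end
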